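(* Every associative Clifford quasiNil-algebra of rank $4$ with nilpotency index $3$ is equivalent either to one of the following algebras or to the dual of one of them: $\mathcal N_0^4(V^{10},V^{01},S)$ for a bigraded $\mathrm{Cl}(V^{10})\otimes\mathrm{Cl}(V^{01})$-module $S$; $\mathcal N_{(1)}(V,S)$ or $\mathcal N_{(2)}(V,S)$ for a $\mathrm{Cl}(V)$-module $S=S^0\oplus S^1$; $\mathcal N_{(3)}(n)$; $\mathcal N_{(4)}(W,n)$ or $\mathcal N_{(5)}(W,n)$ for a nonzero real subspace $W\subset\mathbb H$ and $n\ge1$.
   Context: All vector spaces are finite-dimensional real. A bilinear map $\mu:X\times Y\to Z$ of Euclidean spaces is isometric if $|\mu(x,y)|=|x||y|$. $\mathrm{Cl}(V)$ is the Clifford algebra of a Euclidean space $V$ with $v\cdot v=-|v|^2$. A "$\mathrm{Cl}(V)$-module $S^0\oplus S^1$" means a $\mathbb Z/2$-graded $\mathrm{Cl}(V)$-module ($VS^0\subset S^1$, $VS^1\subset S^0$) with a Euclidean metric such that $S^0\perp S^1$ and each $v\in V$ acts skew-symmetrically; $V\times S^0\to S^1,(v,s)\mapsto v\cdot s$ and $S^0\times V\to S^1,(s,v)\mapsto v\cdot s$ are Clifford multiplications. A quasiNil-algebra of rank $n$: Euclidean space $\mathcal N=\bigoplus_{1\le i<j\le n}\mathcal N_{ij}$ (orthogonal) with isometric bilinear $\mu_{ijk}:\mathcal N_{ij}\times\mathcal N_{jk}\to\mathcal N_{ik}$ ($i<j<k$), product $(AB)_{ik}=\sum_j\mu_{ijk}(a_{ij},b_{jk})$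 on strictly upper triangular matrices $A=(a_{ij})$, $a_{ij}\in\mathcal N_{ij}$. Clifford: every nonzero $\mu_{ijk}$ is a Clifford multiplication (either $\mathcal N_{jk}\oplus\mathcal N_{ik}$ is a $\mathrm{Cl}(\mathcal N_{ij})$-module with $\mu_{ijk}(x,y)=x\cdot y$, or $\mathcal N_{ij}\oplus\mathcal N_{ik}$ is a $\mathrm{Cl}(\mathcal N_{jk})$-module with $\mu_{ijk}(x,y)=y\cdot x$). Nilpotency index: largest $m$ with $i_0<\dots<i_m$, all $\mathcal N_{i_{r-1}i_r}\ne0$. Isomorphism: linear isometry preserving each $\mathcal N_{ij}$ and the products; equivalence: isomorphism after a renumbering of indices by a permutation $\sigma$ with $\sigma(i)<\sigma(j)$ whenever $\mathcal N_{ij}\neq0$. Dual: $\mathcal N^\tau_{ij}=\mathcal N_{n+1-j,n+1-i}$, $\mu^\tau_{ijk}(x,y)=\mu_{n+1-k,n+1-j,n+1-i}(y,x)$. The algebras (all spaces nonzero): $\mathcal N_0^4(V^{10},V^{01},S)$: $S=S^{00}\oplus S^{10}\oplus S^{01}\oplus S^{11}$ a $\mathbb Z/2\times\mathbb Z/2$-graded module over $\mathrm{Cl}(V^{10})\otimes\mathrm{Cl}(V^{01})$ (ordinary tensor product; $V^{10}$ and $V^{01}$ commute), $V^{10}S^{ab}\subset S^{a+1,b}$, $V^{01}S^{ab}\subset S^{a,b+1}$, with a Euclidean metric making the summands orthogonal and all elements of $V^{10}\cup V^{01}$ skew-symmetric; $\mathcal N_{12}=V^{10},\mathcal N_{13}=S^{10},\mathcal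 N_{14}=S^{11},\mathcal N_{23}=S^{00},\mathcal N_{24}=S^{01},\mathcal N_{34}=V^{01}$; $\mu_{123}(v,s)=vs,\mu_{124}(v,s)=vs,\mu_{234}(s,w)=ws,\mu_{134}(s,w)=ws$. $\mathcal N_{(1)}(V,S)$: $\mathcal N_{12}=\mathbb R,\mathcal N_{13}=V,\mathcal N_{14}=S^1,\mathcal N_{23}=V,\mathcal N_{24}=S^1,\mathcal N_{34}=S^0$; $\mu_{123},\mu_{124}$ scalar multiplication; $\mu_{234}(v,s)=\mu_{134}(v,s)=v\cdot s$. $\mathcal N_{(2)}(V,S)$: $\mathcal N_{12}=V,\mathcal N_{13}=V,\mathcal N_{14}=S^0,\mathcal N_{23}=\mathbb R,\mathcal N_{24}=S^1,\mathcal N_{34}=S^1$; $\mu_{123}(v,a)=av$, $\mu_{234}(a,s)=as$; $\mu_{124}(v,s)=\mu_{134}(v,s)=v\cdot s$ ($V\times S^1\to S^0$). For $\mathbb A\in\{\mathbb C,\mathbb H\}$, $\mathbb A^n$ has $\langle x,y\rangle=\mathrm{Re}\sum x_i\bar y_i$ and left scalar multiplication. $\mathcal N_{(3)}(n)$: $\mathcal N_{12}=\mathcal N_{13}=\mathcal N_{23}=\mathbb C$, $\mathcal N_{14}=\mathcal N_{24}=\mathcal N_{34}=\mathbb C^n$, all $\mu_{ijk}(x,y)=xy$. $\mathcal N_{(4)}(W,n)$: $\mathcal N_{12}=W$, $\mathcal N_{13}=\mathcal N_{23}=\mathbb H$, $\mathcal N_{14}=\mathcal N_{24}=\mathcal N_{34}=\mathbb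 H^n$, all $\mu_{ijk}(x,y)=xy$. $\mathcal N_{(5)}(W,n)$: $\mathcal N_{12}=\mathcal N_{13}=\mathbb H$, $\mathcal N_{23}=W$, $\mathcal N_{14}=\mathcal N_{24}=\mathcal N_{34}=\mathbb H^n$, all $\mu_{ijk}(x,y)=xy$. *)

theory Defs
  imports "HOL-Analysis.Analysis"
begin

typedef fsr = "{f :: nat \<Rightarrow> real. finite {i. f i \<noteq> 0}}"
  morphisms coord Abs_fsr
  by (rule exI[of _ "\<lambda>_. 0"]) simp

setup_lifting type_definition_fsr

lemma fsr_eqI: "(\<And>i. coord x i = coord y i) \<Longrightarrow> x = y"
  by (metis coord_inject ext)

instantiation fsr :: real_vector
begin
lift_definition zero_fsr :: fsr is "\<lambda>_. 0" by simp
lift_definition plus_fsr :: "fsr \<Rightarrow> fsr \<Rightarrow> fsr" is "\<lambda>f g i. f i + g i"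
  by (rule finite_subset[rotated], erule (1) finite_UnI) auto
lift_definition uminus_fsr :: "fsr \<Rightarrow> fsr" is "\<lambda>f i. - f i" by simp
lift_definition minus_fsr :: "fsr \<Rightarrow> fsr \<Rightarrow> fsr" is "\<lambda>f g i. f i - g i"
  by (rule finite_subset[rotated], erule (1) finite_UnI) auto
lift_definition scaleR_fsr :: "real \<Rightarrow> fsr \<Rightarrow> fsr" is "\<lambda>c f i. c * f i"
  by (rule finite_subset[rotated], assumption) auto
instance
  by standard (rule fsr_eqI; transfer; simp add: algebra_simps)+
end

lemma coord_zero [simp]: "coord 0 i = 0" by transfer simp
lemma coord_add [simp]: "coord (x + y) i = coord x i + coord y i" by transfer simp
lemma coord_scaleR [simp]: "coord (c *\<^sub>R x) i = c * coord x i" by transfer simp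
lemma finite_supp_fsr [simp]: "finite {i. coord x i \<noteq> 0}" using coord by auto

definition supp_fsr :: "fsr \<Rightarrow> nat set" where "supp_fsr x = {i. coord x i \<noteq> 0}"

lemma sum_supp_fsr:
  assumes "finite T" "supp_fsr x \<subseteq> T"
  shows "(\<Sum>i\<in>supp_fsr x. coord x i * f i) = (\<Sum>i\<in>T. coord x i * f i)"
  by (rule sum.mono_neutral_left) (use assms in \<open>auto simp: supp_fsr_def\<close>)

instantiation fsr :: real_inner
begin
definition inner_fsr :: "fsr \<Rightarrow> fsr \<Rightarrow> real" where
  "inner_fsr x y = (\<Sum>i\<in>supp_fsr x. coord x i * coord y i)"
definition norm_fsr :: "fsr \<Rightarrow> real" where "norm_fsr x = sqrt (inner x x)"
definition dist_fsr :: "fsr \<Rightarrow> fsr \<Rightarrow> real" where "dist_fsr x y = norm (x - y)"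
definition sgn_fsr :: "fsr \<Rightarrow> fsr" where "sgn_fsr x = x /\<^sub>R norm x"
definition uniformity_fsr :: "(fsr \<times> fsr) filter" where
  "uniformity_fsr = (INF e\<in>{0<..}. principal {(x, y). dist x y < e})"
definition open_fsr :: "fsr set \<Rightarrow> bool" where
  "open_fsr U = (\<forall>x\<in>U. eventually (\<lambda>(x', y). x' = x \<longrightarrow> y \<in> U) uniformity)"
instance proof
  fix r :: real and x y z :: fsr
  have fin: "finite (supp_fsr x)" "finite (supp_fsr y)" "finite (supp_fsr z)"
    by (auto simp: supp_fsr_def)
  show "inner x y = inner y x"
    unfolding inner_fsr_def
    using sum_supp_fsr[of "supp_fsr x \<union> supp_fsr y" x "coord y"]
          sum_supp_fsr[of "supp_fsr x \<union> supp_fsr y" y "coord x"] fin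
    by (simp add: mult.commute)
  have "supp_fsr (x + y) \<subseteq> supp_fsr x \<union> supp_fsr y" by (auto simp: supp_fsr_def)
  then show "inner (x + y) z = inner x z + inner y z"
    unfolding inner_fsr_def
    using sum_supp_fsr[of "supp_fsr x \<union> supp_fsr y" "x + y" "coord z"]
          sum_supp_fsr[of "supp_fsr x \<union> supp_fsr y" y "coord z"]
          sum_supp_fsr[of "supp_fsr x \<union> supp_fsr y" x "coord z"] fin
    by (simp add: distrib_right sum.distrib)
  have "supp_fsr (r *\<^sub>R x) \<subseteq> supp_fsr x" by (auto simp: supp_fsr_def)
  then show "inner (r *\<^sub>R x) y = r * inner x y"
    unfolding inner_fsr_def
    using sum_supp_fsr[of "supp_fsr x" "r *\<^sub>R x" "coord y"] fin
    by (simp add: sum_distrib_left mult.assoc)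
  show "0 \<le> inner x x" unfolding inner_fsr_def by (simp add: sum_nonneg)
  show "inner x x = 0 \<longleftrightarrow> x = 0"
  proof
    assume "inner x x = 0"
    then have "\<forall>i\<in>supp_fsr x. coord x i * coord x i = 0"
      unfolding inner_fsr_def using fin by (subst (asm) sum_nonneg_eq_0_iff) auto
    then show "x = 0" by (intro fsr_eqI) (auto simp: supp_fsr_def)
  qed (simp add: inner_fsr_def supp_fsr_def)
  show "norm x = sqrt (inner x x)" by (simp add: norm_fsr_def)
qed (simp_all add: dist_fsr_def sgn_fsr_def uniformity_fsr_def open_fsr_def)
end


definition lin_on :: "'a::real_vector set \<Rightarrow> ('a \<Rightarrow> 'b::real_vector) \<Rightarrow> bool" where
  "lin_on X f \<longleftrightarrow> (\<forall>x\<in>X. \<forall>y\<in>X. f (x + y) = f x + f y) \<and> (\<forall>c. \<forall>x\<in>X. f (c *\<^sub>R x) = c *\<^sub>R f x)"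

text \<open>A Euclidean space = finite-dimensional linear subspace of a real inner product space.\<close>
definition fd_subspace :: "'a::real_vector set \<Rightarrow> bool" where
  "fd_subspace X \<longleftrightarrow> subspace X \<and> (\<exists>B. finite B \<and> X = span B)"

definition bilinear_on :: "'a::real_vector set \<Rightarrow> 'b::real_vector set \<Rightarrow> ('a \<Rightarrow> 'b \<Rightarrow> 'c::real_vector) \<Rightarrow> bool" where
  "bilinear_on X Y m \<longleftrightarrow> (\<forall>x\<in>X. lin_on Y (m x)) \<and> (\<forall>y\<in>Y. lin_on X (\<lambda>x. m x y))"

definition isometric_bilinear ::
  "'a::real_inner set \<Rightarrow> 'b::real_inner set \<Rightarrow> 'c::real_inner set \<Rightarrow> ('a \<Rightarrow> 'b \<Rightarrow> 'c) \<Rightarrow> bool" where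
  "isometric_bilinear X Y Z m \<longleftrightarrow> bilinear_on X Y m \<and>
     (\<forall>x\<in>X. \<forall>y\<in>Y. m x y \<in> Z \<and> norm (m x y) = norm x * norm y)"

text \<open>\<open>S0 \<oplus> S1\<close> (orthogonal external direct sum) is a \<open>\<int>/2\<close>-graded \<open>Cl(V)\<close>-module, with
  \<open>c0 v s = v \<cdot> s\<close> for \<open>s \<in> S0\<close> and \<open>c1 v t = v \<cdot> t\<close> for \<open>t \<in> S1\<close>; the relations
  \<open>v \<cdot> v = -|v|^2\<close> and skew-symmetry of every \<open>v \<in> V\<close> on \<open>S0 \<oplus> S1\<close>.\<close>
definition graded_cl_module ::
  "'a::real_inner set \<Rightarrow> 'b::real_inner set \<Rightarrow> 'c::real_inner set \<Rightarrow>
   ('a \<Rightarrow> 'b \<Rightarrow> 'c) \<Rightarrow> ('a \<Rightarrow> 'c \<Rightarrow> 'b) \<Rightarrow> bool" where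
  "graded_cl_module V S0 S1 c0 c1 \<longleftrightarrow>
     fd_subspace V \<and> fd_subspace S0 \<and> fd_subspace S1 \<and>
     bilinear_on V S0 c0 \<and> bilinear_on V S1 c1 \<and>
     (\<forall>v\<in>V. \<forall>s\<in>S0. c0 v s \<in> S1) \<and> (\<forall>v\<in>V. \<forall>t\<in>S1. c1 v t \<in> S0) \<and>
     (\<forall>v\<in>V. \<forall>s\<in>S0. c1 v (c0 v s) = - ((norm v)\<^sup>2 *\<^sub>R s)) \<and>
     (\<forall>v\<in>V. \<forall>t\<in>S1. c0 v (c1 v t) = - ((norm v)\<^sup>2 *\<^sub>R t)) \<and>
     (\<forall>v\<in>V. \<forall>s\<in>S0. \<forall>t\<in>S1. inner (c0 v s) t = - inner s (c1 v t))"

definition clifford_mult ::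
  "'a::real_inner set \<Rightarrow> 'b::real_inner set \<Rightarrow> 'c::real_inner set \<Rightarrow> ('a \<Rightarrow> 'b \<Rightarrow> 'c) \<Rightarrow> bool" where
  "clifford_mult V S0 S1 m \<longleftrightarrow> (\<exists>c1. graded_cl_module V S0 S1 m c1)"

text \<open>An algebra of rank \<open>n\<close>: component spaces \<open>Sp i j\<close> (for \<open>1 \<le> i < j \<le> n\<close>) and products
  \<open>Mu i j k : Sp i j \<times> Sp j k \<rightarrow> Sp i k\<close>. The whole algebra is the orthogonal (external) direct sum
  of the components, i.e. the strictly upper triangular matrices with entries in the components;
  values outside the index range are irrelevant.\<close>
record 'v qna =
  Sp :: "nat \<Rightarrow> nat \<Rightarrow> 'v set"
  Mu :: "nat \<Rightarrow> nat \<Rightarrow> nat \<Rightarrow> 'v \<Rightarrow> 'v \<Rightarrow> 'v"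

definition quasiNil :: "nat \<Rightarrow> 'v::real_inner qna \<Rightarrow> bool" where
  "quasiNil n A \<longleftrightarrow>
     (\<forall>i j. 1 \<le> i \<and> i < j \<and> j \<le> n \<longrightarrow> fd_subspace (Sp A i j)) \<and>
     (\<forall>i j k. 1 \<le> i \<and> i < j \<and> j < k \<and> k \<le> n \<longrightarrow>
        isometric_bilinear (Sp A i j) (Sp A j k) (Sp A i k) (Mu A i j k))"

definition qn_clifford :: "nat \<Rightarrow> 'v::real_inner qna \<Rightarrow> bool" where
  "qn_clifford n A \<longleftrightarrow>
     (\<forall>i j k. 1 \<le> i \<and> i < j \<and> j < k \<and> k \<le> n \<longrightarrow>
        (\<forall>x\<in>Sp A i j. \<forall>y\<in>Sp A j k. Mu A i j k x y = 0) \<or>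
        clifford_mult (Sp A i j) (Sp A j k) (Sp A i k) (Mu A i j k) \<or>
        clifford_mult (Sp A j k) (Sp A i j) (Sp A i k) (\<lambda>y x. Mu A i j k x y))"

definition qn_elem :: "nat \<Rightarrow> 'v::real_inner qna \<Rightarrow> (nat \<Rightarrow> nat \<Rightarrow> 'v) \<Rightarrow> bool" where
  "qn_elem n A M \<longleftrightarrow>
     (\<forall>i j. (1 \<le> i \<and> i < j \<and> j \<le> n \<longrightarrow> M i j \<in> Sp A i j) \<and>
            (\<not> (1 \<le> i \<and> i < j \<and> j \<le> n) \<longrightarrow> M i j = 0))"

definition qn_prod :: "nat \<Rightarrow> 'v::real_inner qna \<Rightarrow> (nat \<Rightarrow> nat \<Rightarrow> 'v) \<Rightarrow> (nat \<Rightarrow> nat \<Rightarrow> 'v) \<Rightarrow> (nat \<Rightarrow> nat \<Rightarrow> 'v)" where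
  "qn_prod n A M N = (\<lambda>i k. if 1 \<le> i \<and> i < k \<and> k \<le> n
      then (\<Sum>j\<in>{i<..<k}. Mu A i j k (M i j) (N j k)) else 0)"

definition qn_assoc :: "nat \<Rightarrow> 'v::real_inner qna \<Rightarrow> bool" where
  "qn_assoc n A \<longleftrightarrow>
     (\<forall>M N P. qn_elem n A M \<and> qn_elem n A N \<and> qn_elem n A P \<longrightarrow>
        qn_prod n A (qn_prod n A M N) P = qn_prod n A M (qn_prod n A N P))"

definition has_chain :: "nat \<Rightarrow> 'v::real_inner qna \<Rightarrow> nat \<Rightarrow> bool" where
  "has_chain n A m \<longleftrightarrow>
     (\<exists>f::nat \<Rightarrow> nat. 1 \<le> f 0 \<and> f m \<le> n \<and>
        (\<forall>r<m. f r < f (Suc r) \<and> Sp A (f r) (f (Suc r)) \<noteq> {0}))"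

definition nil_index :: "nat \<Rightarrow> 'v::real_inner qna \<Rightarrow> nat" where
  "nil_index n A = (GREATEST m. has_chain n A m)"

definition qn_iso :: "nat \<Rightarrow> 'v::real_inner qna \<Rightarrow> 'w::real_inner qna \<Rightarrow> bool" where
  "qn_iso n A B \<longleftrightarrow> (\<exists>\<phi> :: nat \<Rightarrow> nat \<Rightarrow> 'v \<Rightarrow> 'w.
     (\<forall>i j. 1 \<le> i \<and> i < j \<and> j \<le> n \<longrightarrow>
        lin_on (Sp A i j) (\<phi> i j) \<and> bij_betw (\<phi> i j) (Sp A i j) (Sp B i j) \<and>
        (\<forall>x\<in>Sp A i j. norm (\<phi> i j x) = norm x)) \<and>
     (\<forall>i j k. 1 \<le> i \<and> i < j \<and> j < k \<and> k \<le> n \<longrightarrow>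
        (\<forall>x\<in>Sp A i j. \<forall>y\<in>Sp A j k. \<phi> i k (Mu A i j k x y) = Mu B i j k (\<phi> i j x) (\<phi> j k y))))"

definition renum :: "(nat \<Rightarrow> nat) \<Rightarrow> 'v::real_inner qna \<Rightarrow> 'v qna" where
  "renum \<sigma> A =
     \<lparr> Sp = (\<lambda>a b. if inv \<sigma> a < inv \<sigma> b then Sp A (inv \<sigma> a) (inv \<sigma> b) else {0}),
       Mu = (\<lambda>a b c x y. if inv \<sigma> a < inv \<sigma> b \<and> inv \<sigma> b < inv \<sigma> c
                then Mu A (inv \<sigma> a) (inv \<sigma> b) (inv \<sigma> c) x y else 0) \<rparr>"

definition qn_equiv :: "nat \<Rightarrow> 'v::real_inner qna \<Rightarrow> 'w::real_inner qna \<Rightarrow> bool" where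
  "qn_equiv n A B \<longleftrightarrow> (\<exists>\<sigma>. \<sigma> permutes {1..n} \<and>
     (\<forall>i j. 1 \<le> i \<and> i < j \<and> j \<le> n \<and> Sp A i j \<noteq> {0} \<longrightarrow> \<sigma> i < \<sigma> j) \<and>
     qn_iso n (renum \<sigma> A) B)"

definition qn_dual :: "nat \<Rightarrow> 'v::real_inner qna \<Rightarrow> 'v qna" where
  "qn_dual n A = \<lparr> Sp = (\<lambda>i j. Sp A (n + 1 - j) (n + 1 - i)),
                   Mu = (\<lambda>i j k x y. Mu A (n + 1 - k) (n + 1 - j) (n + 1 - i) y x) \<rparr>"

definition sp4 :: "'v set \<Rightarrow> 'v set \<Rightarrow> 'v set \<Rightarrow> 'v set \<Rightarrow> 'v set \<Rightarrow> 'v set \<Rightarrow> nat \<Rightarrow> nat \<Rightarrow> 'v::zero set" where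
  "sp4 N12 N13 N14 N23 N24 N34 i j =
     (if i = 1 \<and> j = 2 then N12 else if i = 1 \<and> j = 3 then N13 else if i = 1 \<and> j = 4 then N14
      else if i = 2 \<and> j = 3 then N23 else if i = 2 \<and> j = 4 then N24 else if i = 3 \<and> j = 4 then N34
      else {0})"

definition mu4 :: "('v \<Rightarrow> 'v \<Rightarrow> 'v) \<Rightarrow> ('v \<Rightarrow> 'v \<Rightarrow> 'v) \<Rightarrow> ('v \<Rightarrow> 'v \<Rightarrow> 'v) \<Rightarrow> ('v \<Rightarrow> 'v \<Rightarrow> 'v)
     \<Rightarrow> nat \<Rightarrow> nat \<Rightarrow> nat \<Rightarrow> 'v \<Rightarrow> 'v \<Rightarrow> 'v::zero" where
  "mu4 m123 m124 m134 m234 i j k =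
     (if i = 1 \<and> j = 2 \<and> k = 3 then m123 else if i = 1 \<and> j = 2 \<and> k = 4 then m124
      else if i = 1 \<and> j = 3 \<and> k = 4 then m134 else if i = 2 \<and> j = 3 \<and> k = 4 then m234
      else (\<lambda>x y. 0))"

definition coordsp :: "nat \<Rightarrow> fsr set" where
  "coordsp m = {x. \<forall>i\<ge>m. coord x i = 0}"

definition Rline :: "fsr set" where "Rline = coordsp 1"
definition rmul :: "fsr \<Rightarrow> fsr \<Rightarrow> fsr" where "rmul a v = coord a 0 *\<^sub>R v"

text \<open>\<open>\<complex>\<^sup>n = coordsp (2n)\<close>, coordinate \<open>k\<close> being \<open>Complex (x\<^sub>2\<^sub>k) (x\<^sub>2\<^sub>k\<^sub>+\<^sub>1)\<close>; the inner product of \<open>fsr\<close>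
  is then \<open>Re \<Sum> x\<^sub>k conj y\<^sub>k\<close>. \<open>cmul x y\<close> is left multiplication of \<open>y \<in> \<complex>\<^sup>n\<close> by \<open>x \<in> \<complex>\<close>.\<close>
definition Cn :: "nat \<Rightarrow> fsr set" where "Cn n = coordsp (2 * n)"
definition cmul :: "fsr \<Rightarrow> fsr \<Rightarrow> fsr" where
  "cmul x y = Abs_fsr (\<lambda>i.
     let z = Complex (coord x 0) (coord x 1) * Complex (coord y (2 * (i div 2))) (coord y (2 * (i div 2) + 1))
     in if even i then Re z else Im z)"

text \<open>Quaternions as 4-tuples \<open>a + b i + c j + d k\<close> with the Hamilton product.\<close>
definition hmult :: "real \<times> real \<times> real \<times> real \<Rightarrow> real \<times> real \<times> real \<times> real \<Rightarrow> real \<times> real \<times> real \<times> real" where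
  "hmult p q = (case p of (a1, b1, c1, d1) \<Rightarrow> case q of (a2, b2, c2, d2) \<Rightarrow>
     (a1*a2 - b1*b2 - c1*c2 - d1*d2,
      a1*b2 + b1*a2 + c1*d2 - d1*c2,
      a1*c2 - b1*d2 + c1*a2 + d1*b2,
      a1*d2 + b1*c2 - c1*b2 + d1*a2))"

text \<open>\<open>\<bbbH>\<^sup>n = coordsp (4n)\<close>, coordinate \<open>k\<close> being the quaternion with components \<open>x\<^sub>4\<^sub>k, \<dots>, x\<^sub>4\<^sub>k\<^sub>+\<^sub>3\<close>;
  \<open>qmul x y\<close> is left multiplication of \<open>y \<in> \<bbbH>\<^sup>n\<close> by \<open>x \<in> \<bbbH>\<close>.\<close>
definition Hn :: "nat \<Rightarrow> fsr set" where "Hn n = coordsp (4 * n)"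
definition qmul :: "fsr \<Rightarrow> fsr \<Rightarrow> fsr" where
  "qmul x y = Abs_fsr (\<lambda>i.
     let b = 4 * (i div 4);
         p = hmult (coord x 0, coord x 1, coord x 2, coord x 3)
                   (coord y b, coord y (b + 1), coord y (b + 2), coord y (b + 3))
     in (case p of (p0, p1, p2, p3) \<Rightarrow> [p0, p1, p2, p3] ! (i mod 4)))"

text \<open>Bigraded \<open>Cl(V10) \<otimes> Cl(V01)\<close>-module \<open>S00 \<oplus> S10 \<oplus> S01 \<oplus> S11\<close>:
  \<open>l0, l0'\<close> = action of \<open>V10\<close> on \<open>S00 \<leftrightarrow> S10\<close>, \<open>l1, l1'\<close> on \<open>S01 \<leftrightarrow> S11\<close>,
  \<open>r0, r0'\<close> = action of \<open>V01\<close> on \<open>S00 \<leftrightarrow> S01\<close>, \<open>r1, r1'\<close> on \<open>S10 \<leftrightarrow> S11\<close>;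
  the actions of \<open>V10\<close> and \<open>V01\<close> commute.\<close>
definition bigraded_module ::
  "fsr set \<Rightarrow> fsr set \<Rightarrow> fsr set \<Rightarrow> fsr set \<Rightarrow> fsr set \<Rightarrow> fsr set \<Rightarrow>
   (fsr \<Rightarrow> fsr \<Rightarrow> fsr) \<Rightarrow> (fsr \<Rightarrow> fsr \<Rightarrow> fsr) \<Rightarrow> (fsr \<Rightarrow> fsr \<Rightarrow> fsr) \<Rightarrow> (fsr \<Rightarrow> fsr \<Rightarrow> fsr) \<Rightarrow>
   (fsr \<Rightarrow> fsr \<Rightarrow> fsr) \<Rightarrow> (fsr \<Rightarrow> fsr \<Rightarrow> fsr) \<Rightarrow> (fsr \<Rightarrow> fsr \<Rightarrow> fsr) \<Rightarrow> (fsr \<Rightarrow> fsr \<Rightarrow> fsr) \<Rightarrow> bool" where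
  "bigraded_module V10 V01 S00 S10 S01 S11 l0 l0' l1 l1' r0 r0' r1 r1' \<longleftrightarrow>
     graded_cl_module V10 S00 S10 l0 l0' \<and> graded_cl_module V10 S01 S11 l1 l1' \<and>
     graded_cl_module V01 S00 S01 r0 r0' \<and> graded_cl_module V01 S10 S11 r1 r1' \<and>
     (\<forall>v\<in>V10. \<forall>w\<in>V01.
        (\<forall>s\<in>S00. r1 w (l0 v s) = l1 v (r0 w s)) \<and>
        (\<forall>s\<in>S10. l1' v (r1 w s) = r0 w (l0' v s)) \<and>
        (\<forall>s\<in>S01. r1' w (l1 v s) = l0 v (r0' w s)) \<and>
        (\<forall>s\<in>S11. l0' v (r1' w s) = r0' w (l1' v s)))"

definition N04 ::
  "fsr set \<Rightarrow> fsr set \<Rightarrow> fsr set \<Rightarrow> fsr set \<Rightarrow> fsr set \<Rightarrow> fsr set \<Rightarrow>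
   (fsr \<Rightarrow> fsr \<Rightarrow> fsr) \<Rightarrow> (fsr \<Rightarrow> fsr \<Rightarrow> fsr) \<Rightarrow> (fsr \<Rightarrow> fsr \<Rightarrow> fsr) \<Rightarrow> (fsr \<Rightarrow> fsr \<Rightarrow> fsr) \<Rightarrow> fsr qna" where
  "N04 V10 V01 S00 S10 S01 S11 l0 l1 r0 r1 =
     \<lparr> Sp = sp4 V10 S10 S11 S00 S01 V01,
       Mu = mu4 (\<lambda>v s. l0 v s) (\<lambda>v s. l1 v s) (\<lambda>s w. r1 w s) (\<lambda>s w. r0 w s) \<rparr>"

definition N04_family :: "fsr qna set" where
  "N04_family = {N04 V10 V01 S00 S10 S01 S11 l0 l1 r0 r1 | V10 V01 S00 S10 S01 S11 l0 l0' l1 l1' r0 r0' r1 r1'.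
      bigraded_module V10 V01 S00 S10 S01 S11 l0 l0' l1 l1' r0 r0' r1 r1' \<and>
      V10 \<noteq> {0} \<and> V01 \<noteq> {0} \<and> S00 \<noteq> {0} \<and> S10 \<noteq> {0} \<and> S01 \<noteq> {0} \<and> S11 \<noteq> {0}}"

definition N1 :: "fsr set \<Rightarrow> fsr set \<Rightarrow> fsr set \<Rightarrow> (fsr \<Rightarrow> fsr \<Rightarrow> fsr) \<Rightarrow> fsr qna" where
  "N1 V S0 S1 c0 = \<lparr> Sp = sp4 Rline V S1 V S1 S0, Mu = mu4 rmul rmul c0 c0 \<rparr>"

definition N2 :: "fsr set \<Rightarrow> fsr set \<Rightarrow> fsr set \<Rightarrow> (fsr \<Rightarrow> fsr \<Rightarrow> fsr) \<Rightarrow> fsr qna" where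
  "N2 V S0 S1 c1 = \<lparr> Sp = sp4 V V S0 Rline S1 S1,
                     Mu = mu4 (\<lambda>v a. rmul a v) c1 c1 rmul \<rparr>"

definition N1_family :: "fsr qna set" where
  "N1_family = {N1 V S0 S1 c0 | V S0 S1 c0 c1.
      graded_cl_module V S0 S1 c0 c1 \<and> V \<noteq> {0} \<and> S0 \<noteq> {0} \<and> S1 \<noteq> {0}}"

definition N2_family :: "fsr qna set" where
  "N2_family = {N2 V S0 S1 c1 | V S0 S1 c0 c1.
      graded_cl_module V S0 S1 c0 c1 \<and> V \<noteq> {0} \<and> S0 \<noteq> {0} \<and> S1 \<noteq> {0}}"

definition N3 :: "nat \<Rightarrow> fsr qna" where
  "N3 n = \<lparr> Sp = sp4 (Cn 1) (Cn 1) (Cn n) (Cn 1) (Cn n) (Cn n), Mu = mu4 cmul cmul cmul cmul \<rparr>"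

definition N4 :: "fsr set \<Rightarrow> nat \<Rightarrow> fsr qna" where
  "N4 W n = \<lparr> Sp = sp4 W (Hn 1) (Hn n) (Hn 1) (Hn n) (Hn n), Mu = mu4 qmul qmul qmul qmul \<rparr>"

definition N5 :: "fsr set \<Rightarrow> nat \<Rightarrow> fsr qna" where
  "N5 W n = \<lparr> Sp = sp4 (Hn 1) (Hn 1) (Hn n) W (Hn n) (Hn n), Mu = mu4 qmul qmul qmul qmul \<rparr>"

definition N3_family :: "fsr qna set" where
  "N3_family = {N3 n | n. n \<ge> 1}"

definition N4_family :: "fsr qna set" where
  "N4_family = {N4 W n | W n. subspace W \<and> W \<subseteq> Hn 1 \<and> W \<noteq> {0} \<and> n \<ge> 1}"

definition N5_family :: "fsr qna set" where
  "N5_family = {N5 W n | W n. subspace W \<and> W \<subseteq> Hn 1 \<and> W \<noteq> {0} \<and> n \<ge> 1}"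

end

theory Submission
  imports Defs
begin

text \<open>Every \<open>N\<^sub>i\<^sub>j\<close> is nonzero, so each product is a Clifford multiplication, which for an isometric
  product just means that its target has the dimension of one of its factors. Comparing the six
  dimensions leaves, up to duality, two situations. If \<open>N13\<close>, \<open>N14\<close>, \<open>N23\<close>, \<open>N24\<close> have equal
  dimensions, associativity is the commutation relation of a bigraded module. If \<open>N14\<close>, \<open>N24\<close>,
  \<open>N34\<close> have equal dimensions, unit vectors of \<open>N12\<close> and \<open>N23\<close> identify these three spaces, and
  \<open>N12\<close>, \<open>N13\<close>, \<open>N23\<close> become linear spaces of similarities of \<open>N34\<close> containing the identity, with
  composition as product; one of \<open>N12\<close>, \<open>N23\<close> fills \<open>N13\<close>. The other one is then either the real line,
  or the composition closure forces \<open>N13\<close> to be the complex numbers or the quaternions, acting on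
  \<open>N34\<close> by scalar multiplication.\<close>

section \<open>Linear maps and orthonormal families\<close>

text \<open>Dimensions can be compared because multiplication by a unit vector of one factor embeds
  the other factor isometrically into the target; hence no space is larger than \<open>N14\<close>.
  The obstacle in the operator case is that \<open>N13\<close> is not known to be closed under
  composition. Associativity gives only products of an operator from \<open>N12\<close> followed on
  its right by one from \<open>N23\<close>. If \<open>N23\<close> fills \<open>N13\<close>, this
  says that operators from \<open>N12\<close> may be multiplied from the left onto all of
  \<open>N13\<close>; if \<open>N12\<close> fills \<open>N13\<close>, the closure is on the other
  side and adjoints turn it around. One-sided closure is enough: for a unit \<open>I\<close> in the
  smaller space and a unit \<open>J\<close> in \<open>N13\<close>, both orthogonal to the identity
  and to each other, \<open>I J\<close> stays in \<open>N13\<close>, and these four operators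
  already exhaust it. The smaller space survives as the subspace \<open>W\<close> of the
  quaternions; when it is a line, \<open>N13\<close> remains an arbitrary Clifford space
  \<open>V\<close>. All equivalences obtained use the identity renumbering, because
  \<open>N12\<close>, \<open>N23\<close> and \<open>N34\<close> are nonzero from the start.\<close>

lemma fd_subspaceD [dest]: "fd_subspace X \<Longrightarrow> subspace X"
  by (simp add: fd_subspace_def)

lemma lin_on_add: "lin_on X f \<Longrightarrow> x \<in> X \<Longrightarrow> y \<in> X \<Longrightarrow> f (x + y) = f x + f y"
  by (simp add: lin_on_def)

lemma lin_on_scaleR: "lin_on X f \<Longrightarrow> x \<in> X \<Longrightarrow> f (c *\<^sub>R x) = c *\<^sub>R f x"
  by (simp add: lin_on_def)

lemma lin_on_zero: "lin_on X f \<Longrightarrow> x \<in> X \<Longrightarrow> f 0 = 0"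
  using lin_on_scaleR[of X f x 0] by simp

lemma lin_on_diff:
  assumes "subspace X" "lin_on X f" "x \<in> X" "y \<in> X"
  shows "f (x - y) = f x - f y"
  using lin_on_add[OF assms(2), of x "(-1) *\<^sub>R y"] lin_on_scaleR[OF assms(2), of y "-1"] assms
    subspace_scale[of X y "-1"] by simp

lemma lin_on_minus:
  assumes "lin_on X f" "x \<in> X"
  shows "f (- x) = - f x"
  using lin_on_scaleR[OF assms, of "-1"] by simp

lemma lin_on_sum:
  assumes "subspace X" "lin_on X f" "\<And>i. i \<in> I \<Longrightarrow> u i \<in> X"
  shows "f (\<Sum>i\<in>I. c i *\<^sub>R u i) = (\<Sum>i\<in>I. c i *\<^sub>R f (u i))"
proof (cases "finite I")
  case True
  then show ?thesis using assms(3)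
  proof (induction I rule: finite_induct)
    case empty
    show ?case using lin_on_zero[OF assms(2) subspace_0[OF assms(1)]] by simp
  next
    case (insert i I)
    have "(\<Sum>i\<in>I. c i *\<^sub>R u i) \<in> X"
      using insert.prems by (intro subspace_sum[OF assms(1)] subspace_scale[OF assms(1)]) auto
    with insert show ?case
      by (simp add: lin_on_add[OF assms(2)] lin_on_scaleR[OF assms(2)] subspace_scale[OF assms(1)])
  qed
next
  case False
  then show ?thesis using lin_on_zero[OF assms(2) subspace_0[OF assms(1)]] by simp
qed

text \<open>Polarisation with a factor \<open>k\<close>, so that it also covers the similarities
  given by vectors that are not units.\<close>

lemma lin_on_polarize:
  fixes f :: "'a::real_inner \<Rightarrow> 'b::real_inner"
  assumes "subspace X" "lin_on X f" and n: "\<And>x. x \<in> X \<Longrightarrow> norm (f x) = k * norm x"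
    and "x \<in> X" "y \<in> X"
  shows "inner (f x) (f y) = k\<^sup>2 * inner x y"
proof -
  have sq: "inner (f z) (f z) = k\<^sup>2 * inner z z" if "z \<in> X" for z
    using n[OF that] by (metis power2_norm_eq_inner power_mult_distrib)
  have "f (x + y) = f x + f y" using assms by (simp add: lin_on_add)
  moreover have "x + y \<in> X" using assms subspace_add by blast
  ultimately show ?thesis
    using sq[of x] sq[of y] sq[of "x + y"] assms(4,5)
    by (simp add: inner_simps inner_commute algebra_simps)
qed

definition orthonormal_fam :: "(nat \<Rightarrow> 'a::real_inner) \<Rightarrow> nat \<Rightarrow> 'a set \<Rightarrow> bool" where
  "orthonormal_fam u m Z \<longleftrightarrow> (\<forall>i<m. u i \<in> Z) \<and> (\<forall>i<m. \<forall>j<m. inner (u i) (u j) = of_bool (i = j))"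

text \<open>The expansion of every \<open>z\<close> stands in for spanning. Only the first
  \<open>m\<close> values of the family count, so a list lookup such as \<open>(!) [p0, I]\<close>
  can serve as a basis.\<close>

definition onb :: "(nat \<Rightarrow> 'a::real_inner) \<Rightarrow> nat \<Rightarrow> 'a set \<Rightarrow> bool" where
  "onb u m Z \<longleftrightarrow> orthonormal_fam u m Z \<and> (\<forall>z\<in>Z. z = (\<Sum>i<m. inner z (u i) *\<^sub>R u i))"

lemma inner_sum_orthonormal:
  assumes "orthonormal_fam u m Z" "j < m"
  shows "inner (\<Sum>i<m. c i *\<^sub>R u i) (u j) = c j"
proof -
  have "inner (\<Sum>i<m. c i *\<^sub>R u i) (u j) = (\<Sum>i<m. c i * of_bool (i = j))"
    using assms by (simp add: inner_sum_left orthonormal_fam_def)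
  also have "\<dots> = c j" using assms(2) by (subst sum.remove[of _ j]) auto
  finally show ?thesis .
qed

lemma orthonormal_fam_independent:
  assumes "orthonormal_fam u m Z"
  shows "independent (u ` {..<m})" "card (u ` {..<m}) = m"
proof -
  have inj: "inj_on u {..<m}"
  proof (rule inj_onI)
    fix i j assume "i \<in> {..<m}" "j \<in> {..<m}" "u i = u j"
    then have "inner (u i) (u j) = 1" using assms by (auto simp: orthonormal_fam_def)
    then show "i = j" using assms \<open>i \<in> _\<close> \<open>j \<in> _\<close> by (auto simp: orthonormal_fam_def of_bool_def split: if_splits)
  qed
  then show "card (u ` {..<m}) = m" by (simp add: card_image)
  show "independent (u ` {..<m})"
  proof (rule pairwise_orthogonal_independent)
    show "pairwise orthogonal (u ` {..<m})"
      using assms by (auto simp: pairwise_def orthogonal_def orthonormal_fam_def)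
    show "0 \<notin> u ` {..<m}"
    proof
      assume "0 \<in> u ` {..<m}"
      then obtain i where "i < m" "u i = 0" by auto
      moreover from \<open>i < m\<close> have "inner (u i) (u i) = 1" using assms by (simp add: orthonormal_fam_def)
      ultimately show False by simp
    qed
  qed
qed

text \<open>The ambient type may have infinite dimension; finiteness of a basis of \<open>Z\<close>
  comes from the finite spanning set in \<open>fd_subspace\<close>.\<close>

lemma card_independent_le_dim:
  assumes "fd_subspace Z" "independent S" "S \<subseteq> Z"
  shows "card S \<le> dim Z"
proof -
  obtain B where B: "finite B" "Z = span B" using assms by (auto simp: fd_subspace_def)
  obtain B' where B': "B' \<subseteq> Z" "independent B'" "Z \<subseteq> span B'" "card B' = dim Z"
    using basis_exists by blast
  have "finite B'" using independent_span_bound[OF B(1) B'(2)] B B'(1) by auto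
  then show ?thesis using independent_span_bound[OF _ assms(2)] B' assms(3) by (metis subset_trans)
qed

lemma orthonormal_fam_le_dim:
  assumes "fd_subspace Z" "orthonormal_fam u m Z"
  shows "m \<le> dim Z"
  using card_independent_le_dim[OF assms(1) orthonormal_fam_independent(1)[OF assms(2)]]
    orthonormal_fam_independent(2)[OF assms(2)] assms(2)
  by (auto simp: orthonormal_fam_def)

lemma onb_dim:
  assumes "onb u m Z"
  shows "dim Z = m"
proof -
  have o: "orthonormal_fam u m Z" using assms by (simp add: onb_def)
  have "Z \<subseteq> span (u ` {..<m})"
  proof
    fix z assume "z \<in> Z"
    then have "z = (\<Sum>i<m. inner z (u i) *\<^sub>R u i)" using assms by (simp add: onb_def)
    also have "\<dots> \<in> span (u ` {..<m})" by (intro span_sum span_scale span_base) auto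
    finally show "z \<in> span (u ` {..<m})" .
  qed
  then show ?thesis
    using basis_card_eq_dim[of "u ` {..<m}" Z] orthonormal_fam_independent[OF o] o
    by (auto simp: orthonormal_fam_def)
qed

text \<open>Where the expansion of some \<open>z\<close> fails, the remainder is nonzero and
  orthogonal to the family; it only has to be normalised.\<close>

lemma onb_or_extend:
  assumes "subspace Z" "orthonormal_fam u m Z" "\<not> onb u m Z"
  obtains e where "e \<in> Z" "norm e = 1" "\<And>i. i < m \<Longrightarrow> inner e (u i) = 0"
proof -
  obtain z where z: "z \<in> Z" "z \<noteq> (\<Sum>i<m. inner z (u i) *\<^sub>R u i)"
    using assms by (auto simp: onb_def)
  define y where "y = z - (\<Sum>i<m. inner z (u i) *\<^sub>R u i)"
  have "y \<noteq> 0" using z by (simp add: y_def)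
  have "(\<Sum>i<m. inner z (u i) *\<^sub>R u i) \<in> Z"
    using assms by (intro subspace_sum[OF assms(1)] subspace_scale[OF assms(1)]) (auto simp: orthonormal_fam_def)
  then have "y \<in> Z" unfolding y_def using z(1) subspace_diff[OF assms(1)] by blast
  have "inner y (u i) = 0" if "i < m" for i
    unfolding y_def inner_diff_left using inner_sum_orthonormal[OF assms(2) that] by simp
  with \<open>y \<in> Z\<close> \<open>y \<noteq> 0\<close> show ?thesis
    by (intro that[of "y /\<^sub>R norm y"]) (auto intro: subspace_scale[OF assms(1)])
qed

lemma orthonormal_fam_dim_onb:
  assumes "fd_subspace Z" "orthonormal_fam u (dim Z) Z"
  shows "onb u (dim Z) Z"
proof (rule ccontr)
  assume "\<not> ?thesis"
  then obtain e where e: "e \<in> Z" "norm e = 1" "\<And>i. i < dim Z \<Longrightarrow> inner e (u i) = 0"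
    using onb_or_extend assms by blast
  have "orthonormal_fam (u(dim Z := e)) (Suc (dim Z)) Z"
    using e assms(2) by (auto simp: orthonormal_fam_def less_Suc_eq inner_commute norm_eq_1)
  then show False using orthonormal_fam_le_dim[OF assms(1)] by fastforce
qed

text \<open>The hypotheses on \<open>g\<close> make it act like the basis \<open>1\<close>, \<open>1, i\<close> or \<open>1, i, j, k\<close> of a real
  division algebra; with \<open>d = 1\<close> this is the existence of an ordinary orthonormal basis.\<close>
lemma adapted_onb:
  assumes Z: "fd_subspace Z" and d: "d > 0"
    and g0: "\<And>s. s \<in> Z \<Longrightarrow> g 0 s = s"
    and gZ: "\<And>a s. a < d \<Longrightarrow> s \<in> Z \<Longrightarrow> g a s \<in> Z"
    and gn: "\<And>a s. a < d \<Longrightarrow> s \<in> Z \<Longrightarrow> norm (g a s) = norm s"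
    and go: "\<And>a b s. a < d \<Longrightarrow> b < d \<Longrightarrow> a \<noteq> b \<Longrightarrow> s \<in> Z \<Longrightarrow> inner (g a s) (g b s) = 0"
    and gadj: "\<And>a b. a < d \<Longrightarrow> b < d \<Longrightarrow>
       \<exists>c<d. \<exists>\<epsilon>::real. \<forall>s\<in>Z. \<forall>t\<in>Z. inner (g b s) (g a t) = \<epsilon> * inner s (g c t)"
  obtains n e where "\<And>k. k < n \<Longrightarrow> e k \<in> Z" "onb (\<lambda>i. g (i mod d) (e (i div d))) (d * n) Z"
proof -
  define Q where "Q n \<longleftrightarrow> (\<exists>e. (\<forall>k<n. e k \<in> Z) \<and>
     orthonormal_fam (\<lambda>i. g (i mod d) (e (i div d))) (d * n) Z)" for n
  have "Q 0" by (simp add: Q_def orthonormal_fam_def)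
  have bound: "n \<le> dim Z" if "Q n" for n
  proof -
    have "d * n \<le> dim Z" using that orthonormal_fam_le_dim[OF Z] unfolding Q_def by blast
    moreover have "n \<le> d * n" using d by simp
    ultimately show ?thesis by linarith
  qed
  \<comment> \<open>A maximal number of blocks exists by the bound. A vector orthogonal to all of
    them would start another block.\<close>
  obtain n where n: "Q n" "\<not> Q (Suc n)"
    using \<open>Q 0\<close> bound by (metis Suc_n_not_le_n nat_induct)
  then obtain e where e: "\<forall>k<n. e k \<in> Z" and on: "orthonormal_fam (\<lambda>i. g (i mod d) (e (i div d))) (d * n) Z"
    by (auto simp: Q_def)
  have "onb (\<lambda>i. g (i mod d) (e (i div d))) (d * n) Z"
  proof (rule ccontr)
    assume "\<not> ?thesis"
    then obtain f where f: "f \<in> Z" "norm f = 1" "\<And>i. i < d * n \<Longrightarrow> inner f (g (i mod d) (e (i div d))) = 0"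
      using onb_or_extend[OF fd_subspaceD[OF Z] on] by blast
    have f': "inner f (g c (e k)) = 0" if "c < d" "k < n" for c k
    proof -
      have "d * k + c < d * n"
      proof -
        have "d * k + c < d * Suc k" using that by simp
        also have "\<dots> \<le> d * n" using that by (intro mult_left_mono) auto
        finally show ?thesis .
      qed
      from f(3)[OF this] that d show ?thesis by simp
    qed
    define e' where "e' = e(n := f)"
    have e'Z: "e' k \<in> Z" if "k < Suc n" for k using that e f(1) by (auto simp: e'_def less_Suc_eq)
    have idx: "i mod d < d" "i div d < Suc n" if "i < d * Suc n" for i
      using that d by (simp_all add: div_less_iff_less_mult mult.commute del: mult_Suc mult_Suc_right)
    \<comment> \<open>The new block is orthogonal to the old ones: \<open>gadj\<close> moves the
      operator off \<open>f\<close>, and \<open>f\<close> is orthogonal to every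
      \<open>g c (e k)\<close>.\<close>
    have fg: "inner (g b f) (g a (e k)) = 0" if "a < d" "b < d" "k < n" for a b k
    proof -
      from gadj[OF \<open>a < d\<close> \<open>b < d\<close>]
      obtain c \<epsilon> where c: "c < d" "\<forall>s\<in>Z. \<forall>t\<in>Z. inner (g b s) (g a t) = \<epsilon> * inner s (g c t)"
        by blast
      then show ?thesis using that e f(1) f'[of c k] by simp
    qed
    have "orthonormal_fam (\<lambda>i. g (i mod d) (e' (i div d))) (d * Suc n) Z"
      unfolding orthonormal_fam_def
    proof (intro conjI allI impI)
      fix i assume "i < d * Suc n"
      then show "g (i mod d) (e' (i div d)) \<in> Z" using idx e'Z gZ by blast
    next
      fix i j assume ij: "i < d * Suc n" "j < d * Suc n"
      have eq: "i = j \<longleftrightarrow> i mod d = j mod d \<and> i div d = j div d"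
        by (metis div_mod_decomp)
      consider "i div d < n" "j div d < n" | "i div d = n" "j div d < n"
        | "i div d < n" "j div d = n" | "i div d = n" "j div d = n"
        using idx[OF ij(1)] idx[OF ij(2)] by linarith
      then show "inner (g (i mod d) (e' (i div d))) (g (j mod d) (e' (j div d))) = of_bool (i = j)"
      proof cases
        case 1
        then have "i < d * n" "j < d * n" using d
          by (metis div_less_iff_less_mult mult.commute)+
        with 1 on show ?thesis by (simp add: orthonormal_fam_def e'_def)
      next
        case 2
        then show ?thesis using fg[of "j mod d" "i mod d" "j div d"] d by (auto simp: e'_def eq)
      next
        case 3
        then show ?thesis using fg[of "i mod d" "j mod d" "i div d"] d
          by (auto simp: e'_def eq inner_commute)
      next
        case 4
        then show ?thesis using go[of "i mod d" "j mod d" f] gn[of "j mod d" f] f d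
          by (auto simp: e'_def eq norm_eq_1)
      qed
    qed
    with e'Z have "Q (Suc n)" unfolding Q_def by blast
    with n show False by simp
  qed
  with e that show ?thesis by blast
qed

lemma onb_exists:
  assumes "fd_subspace Z"
  obtains u where "onb u (dim Z) Z"
proof -
  obtain n e where "onb (\<lambda>i. (\<lambda>a s. s) (i mod 1) (e (i div 1))) (1 * n) Z"
    by (rule adapted_onb[OF assms, of 1 "\<lambda>a s. s"]) (auto intro: exI[of _ 1])
  then show ?thesis using that onb_dim by (metis (no_types, lifting))
qed

section \<open>Isometries and Clifford multiplications\<close>

definition lin_isometry :: "('a::real_inner \<Rightarrow> 'b::real_inner) \<Rightarrow> 'a set \<Rightarrow> 'b set \<Rightarrow> bool" where
  "lin_isometry f X Y \<longleftrightarrow> lin_on X f \<and> bij_betw f X Y \<and> (\<forall>x\<in>X. norm (f x) = norm x)"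

lemma norm_preserving_inj_on:
  fixes f :: "'a::real_inner \<Rightarrow> 'b::real_inner"
  assumes "subspace X" "lin_on X f" "\<And>x. x \<in> X \<Longrightarrow> norm (f x) = k * norm x" "k \<noteq> 0"
  shows "inj_on f X"
proof (rule inj_onI)
  fix x y assume xy: "x \<in> X" "y \<in> X" "f x = f y"
  then have "norm (f (x - y)) = 0" using lin_on_diff[OF assms(1,2)] by simp
  with assms(3)[of "x - y"] assms(4) xy subspace_diff[OF assms(1)] show "x = y" by simp
qed

lemma lin_isometryI:
  assumes "subspace X" "lin_on X f" "\<And>x. x \<in> X \<Longrightarrow> norm (f x) = norm x" "f ` X = Y"
  shows "lin_isometry f X Y"
  using norm_preserving_inj_on[of X f 1] assms by (auto simp: lin_isometry_def bij_betw_def)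

lemma lin_isometryD:
  assumes "lin_isometry f X Y"
  shows "lin_on X f" "inj_on f X" "f ` X = Y" "\<And>x. x \<in> X \<Longrightarrow> f x \<in> Y"
    "\<And>x. x \<in> X \<Longrightarrow> norm (f x) = norm x"
    "\<And>x. x \<in> X \<Longrightarrow> inv_into X f (f x) = x"
    "\<And>y. y \<in> Y \<Longrightarrow> inv_into X f y \<in> X" "\<And>y. y \<in> Y \<Longrightarrow> f (inv_into X f y) = y"
  using assms by (auto simp: lin_isometry_def bij_betw_def inv_into_into f_inv_into_f)

lemma lin_isometry_inv:
  assumes "subspace X" "lin_isometry f X Y"
  shows "lin_isometry (inv_into X f) Y X"
proof -
  note f = lin_isometryD[OF assms(2)]
  have "lin_on Y (inv_into X f)"
    unfolding lin_on_def
  proof (intro conjI ballI allI)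
    fix y y' assume y: "y \<in> Y" "y' \<in> Y"
    let ?x = "inv_into X f y" and ?x' = "inv_into X f y'"
    have "f (?x + ?x') = y + y'" using f y by (simp add: lin_on_add)
    moreover have "?x + ?x' \<in> X" using f y by (simp add: subspace_add[OF assms(1)])
    ultimately show "inv_into X f (y + y') = ?x + ?x'" using f(6) by metis
  next
    fix c y assume y: "y \<in> Y"
    let ?x = "inv_into X f y"
    have "f (c *\<^sub>R ?x) = c *\<^sub>R y" using f y by (simp add: lin_on_scaleR)
    moreover have "c *\<^sub>R ?x \<in> X" using f y by (simp add: subspace_scale[OF assms(1)])
    ultimately show "inv_into X f (c *\<^sub>R y) = c *\<^sub>R ?x" using f(6) by metis
  qed
  moreover have "norm (inv_into X f y) = norm y" if "y \<in> Y" for y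
    using f(5)[OF f(7)[OF that]] f(8)[OF that] by simp
  moreover have "bij_betw (inv_into X f) Y X"
    using assms(2) bij_betw_inv_into by (auto simp: lin_isometry_def)
  ultimately show ?thesis by (simp add: lin_isometry_def)
qed

lemma lin_isometry_comp:
  assumes "lin_isometry f X Y" "lin_isometry g Y Z"
  shows "lin_isometry (\<lambda>x. g (f x)) X Z"
proof -
  have "bij_betw (\<lambda>x. g (f x)) X Z"
    using assms bij_betw_trans[of f X Y g Z] by (simp add: lin_isometry_def comp_def)
  then show ?thesis
    using lin_isometryD[OF assms(1)] lin_isometryD[OF assms(2)]
    by (auto simp: lin_isometry_def lin_on_def)
qed

lemma subspace_lin_image:
  assumes "subspace X" "lin_on X f"
  shows "subspace (f ` X)"
proof (rule subspaceI)
  show "0 \<in> f ` X"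
    using lin_on_zero[OF assms(2)] subspace_0[OF assms(1)] by (metis image_eqI)
next
  fix x y assume "x \<in> f ` X" "y \<in> f ` X"
  then show "x + y \<in> f ` X" using lin_on_add[OF assms(2)] subspace_add[OF assms(1)]
    by (auto simp flip: lin_on_add[OF assms(2)])
next
  fix c x assume "x \<in> f ` X"
  then show "c *\<^sub>R x \<in> f ` X" using subspace_scale[OF assms(1)]
    by (auto simp flip: lin_on_scaleR[OF assms(2)])
qed

lemma onb_fd_subspace:
  assumes "onb u m Z" "subspace Z"
  shows "fd_subspace Z"
proof -
  have u: "\<And>i. i < m \<Longrightarrow> u i \<in> Z" and z: "\<And>z. z \<in> Z \<Longrightarrow> z = (\<Sum>i<m. inner z (u i) *\<^sub>R u i)"
    using assms(1) by (auto simp: onb_def orthonormal_fam_def)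
  have "Z = span (u ` {..<m})"
  proof
    show "span (u ` {..<m}) \<subseteq> Z" using u by (intro span_minimal[OF _ assms(2)]) auto
    show "Z \<subseteq> span (u ` {..<m})"
    proof
      fix z assume "z \<in> Z"
      then have "z = (\<Sum>i<m. inner z (u i) *\<^sub>R u i)" by (rule z)
      also have "\<dots> \<in> span (u ` {..<m})" by (intro span_sum span_scale span_base) auto
      finally show "z \<in> span (u ` {..<m})" .
    qed
  qed
  then show ?thesis using assms(2) unfolding fd_subspace_def by blast
qed

section \<open>Coordinate spaces and coordinate maps\<close>

definition fsr_unit :: "nat \<Rightarrow> fsr" where
  "fsr_unit i = Abs_fsr (\<lambda>j. of_bool (i = j))"

lemma coord_Abs_fsr: "(\<And>i. i \<ge> m \<Longrightarrow> f i = 0) \<Longrightarrow> coord (Abs_fsr f) = f"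
proof (rule Abs_fsr_inverse)
  assume "\<And>i. i \<ge> m \<Longrightarrow> f i = 0"
  then have "{i. f i \<noteq> 0} \<subseteq> {..<m}" by (auto simp: not_le[symmetric])
  then show "f \<in> {f. finite {i. f i \<noteq> 0}}" using finite_subset by auto
qed

lemma coord_fsr_unit [simp]: "coord (fsr_unit i) j = of_bool (i = j)"
  unfolding fsr_unit_def by (subst coord_Abs_fsr[of "Suc i"]) auto

lemma coord_sum [simp]: "coord (\<Sum>i\<in>I. f i) j = (\<Sum>i\<in>I. coord (f i) j)"
  by (induction I rule: infinite_finite_induct) auto

lemma inner_fsr_unit [simp]: "inner x (fsr_unit i) = coord x i"
proof -
  have "supp_fsr (fsr_unit i) = {i}" by (auto simp: supp_fsr_def)
  then have "inner (fsr_unit i) x = coord x i" by (simp add: inner_fsr_def)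
  then show ?thesis by (simp add: inner_commute)
qed

lemma subspace_coordsp [simp]: "subspace (coordsp m)"
  by (auto simp: subspace_def coordsp_def)

lemma onb_coordsp: "onb fsr_unit m (coordsp m)"
  unfolding onb_def
proof (intro conjI ballI)
  show "orthonormal_fam fsr_unit m (coordsp m)"
    by (auto simp: orthonormal_fam_def coordsp_def)
  fix z assume z: "z \<in> coordsp m"
  show "z = (\<Sum>i<m. inner z (fsr_unit i) *\<^sub>R fsr_unit i)"
  proof (rule fsr_eqI)
    fix j
    show "coord z j = coord (\<Sum>i<m. inner z (fsr_unit i) *\<^sub>R fsr_unit i) j"
    proof (cases "j < m")
      case True
      then show ?thesis by (simp add: sum.remove[of _ j])
    next
      case False
      then have "(\<Sum>x<m. coord z x * of_bool (x = j)) = 0" by (intro sum.neutral) auto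
      with False z show ?thesis by (simp add: coordsp_def)
    qed
  qed
qed

lemma fd_subspace_coordsp [simp]: "fd_subspace (coordsp m)"
  using onb_fd_subspace[OF onb_coordsp] by simp

text \<open>The cut at \<open>m\<close> keeps the support finite and hides the values of
  \<open>u\<close> beyond the basis, which are meaningless for a list lookup.\<close>

definition coordmap :: "(nat \<Rightarrow> 'a::real_inner) \<Rightarrow> nat \<Rightarrow> 'a \<Rightarrow> fsr" where
  "coordmap u m z = Abs_fsr (\<lambda>i. if i < m then inner z (u i) else 0)"

lemma coord_coordmap [simp]: "coord (coordmap u m z) i = (if i < m then inner z (u i) else 0)"
  unfolding coordmap_def by (subst coord_Abs_fsr[of m]) auto

lemma coordmap_sum:
  assumes "orthonormal_fam u m Z" "x \<in> coordsp m"
  shows "coordmap u m (\<Sum>i<m. coord x i *\<^sub>R u i) = x"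
  using assms(2) by (intro fsr_eqI) (auto simp: inner_sum_orthonormal[OF assms(1)] coordsp_def)

lemma lin_isometry_coordmap:
  assumes "subspace Z" "onb u m Z"
  shows "lin_isometry (coordmap u m) Z (coordsp m)"
proof (rule lin_isometryI[OF assms(1)])
  have o: "orthonormal_fam u m Z" using assms by (simp add: onb_def)
  show "lin_on Z (coordmap u m)"
    by (auto simp: lin_on_def inner_add_left intro!: fsr_eqI)
  show "coordmap u m ` Z = coordsp m"
  proof
    show "coordmap u m ` Z \<subseteq> coordsp m" by (auto simp: coordsp_def)
    show "coordsp m \<subseteq> coordmap u m ` Z"
    proof
      fix x assume x: "x \<in> coordsp m"
      have "(\<Sum>i<m. coord x i *\<^sub>R u i) \<in> Z"
        using o by (intro subspace_sum[OF assms(1)] subspace_scale[OF assms(1)]) (auto simp: orthonormal_fam_def)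
      then show "x \<in> coordmap u m ` Z" using coordmap_sum[OF o x] by (metis image_eqI)
    qed
  qed
  fix z assume z: "z \<in> Z"
  \<comment> \<open>Parseval for \<open>u\<close> and for the standard basis: both squared norms are
    the same sum of squared coordinates.\<close>
  have "inner z z = inner z (\<Sum>i<m. inner z (u i) *\<^sub>R u i)" using z assms(2) by (simp add: onb_def)
  also have "\<dots> = (\<Sum>i<m. inner z (u i) * inner z (u i))" by (simp add: inner_sum_right)
  also have "\<dots> = inner (coordmap u m z) (\<Sum>i<m. inner (coordmap u m z) (fsr_unit i) *\<^sub>R fsr_unit i)"
    by (simp add: inner_sum_right del: inner_fsr_unit) simp
  also have "\<dots> = inner (coordmap u m z) (coordmap u m z)"
  proof -
    have "coordmap u m z \<in> coordsp m" by (simp add: coordsp_def)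
    then have "coordmap u m z = (\<Sum>i<m. inner (coordmap u m z) (fsr_unit i) *\<^sub>R fsr_unit i)"
      using onb_coordsp[of m] unfolding onb_def by blast
    then show ?thesis by simp
  qed
  finally show "norm (coordmap u m z) = norm z" by (simp add: norm_eq_sqrt_inner)
qed

lemma lin_isometry_coordsp_exists:
  assumes "fd_subspace Z"
  obtains f where "lin_isometry f Z (coordsp (dim Z))"
  using onb_exists[OF assms] lin_isometry_coordmap fd_subspaceD[OF assms] by metis

section \<open>Isometric bilinear maps and dimensions\<close>

lemma isometric_bilinearD:
  assumes "isometric_bilinear X Y Z m"
  shows "\<And>x. x \<in> X \<Longrightarrow> lin_on Y (m x)" "\<And>y. y \<in> Y \<Longrightarrow> lin_on X (\<lambda>x. m x y)"
    "\<And>x y. x \<in> X \<Longrightarrow> y \<in> Y \<Longrightarrow> m x y \<in> Z" "\<And>x y. x \<in> X \<Longrightarrow> y \<in> Y \<Longrightarrow> norm (m x y) = norm x * norm y"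
  using assms by (auto simp: isometric_bilinear_def bilinear_on_def)

lemma isometric_bilinear_flip:
  "isometric_bilinear X Y Z m \<Longrightarrow> isometric_bilinear Y X Z (\<lambda>y x. m x y)"
  by (auto simp: isometric_bilinear_def bilinear_on_def mult.commute)

lemma isometric_bilinear_transport:
  assumes "isometric_bilinear X Y Z m" "subspace X" "subspace Y"
    "lin_isometry f X X'" "lin_isometry g Y Y'" "lin_isometry h Z Z'"
  shows "isometric_bilinear X' Y' Z' (\<lambda>x y. h (m (inv_into X f x) (inv_into Y g y)))"
proof -
  note m = isometric_bilinearD[OF assms(1)] and h = lin_isometryD[OF assms(6)]
    and f = lin_isometryD[OF lin_isometry_inv[OF assms(2,4)]]
    and g = lin_isometryD[OF lin_isometry_inv[OF assms(3,5)]]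
  have "lin_on Y' (\<lambda>y. h (m (inv_into X f x) (inv_into Y g y)))" if "x \<in> X'" for x
    unfolding lin_on_def using f(4)[OF that] g(4) m(3)
    by (simp add: lin_on_add[OF g(1)] lin_on_add[OF m(1)] lin_on_add[OF h(1)]
        lin_on_scaleR[OF g(1)] lin_on_scaleR[OF m(1)] lin_on_scaleR[OF h(1)])
  moreover have "lin_on X' (\<lambda>x. h (m (inv_into X f x) (inv_into Y g y)))" if "y \<in> Y'" for y
    unfolding lin_on_def using g(4)[OF that] f(4) m(3)
    by (simp add: lin_on_add[OF f(1)] lin_on_add[OF m(2)] lin_on_add[OF h(1)]
        lin_on_scaleR[OF f(1)] lin_on_scaleR[OF m(2)] lin_on_scaleR[OF h(1)])
  ultimately show ?thesis
    using f(4,5) g(4,5) h(4,5) m(3,4)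
    by (auto simp: isometric_bilinear_def bilinear_on_def)
qed

lemma isometric_bilinear_inner:
  assumes "isometric_bilinear X Y Z m" "subspace Y" "x \<in> X" "s \<in> Y" "t \<in> Y"
  shows "inner (m x s) (m x t) = (norm x)\<^sup>2 * inner s t"
  using lin_on_polarize[OF assms(2) isometric_bilinearD(1)[OF assms(1,3)], of "norm x"]
    isometric_bilinearD(4)[OF assms(1,3)] assms(4,5) by blast

lemma isometric_bilinear_inj:
  assumes "isometric_bilinear X Y Z m" "subspace Y" "x \<in> X" "x \<noteq> 0"
  shows "inj_on (m x) Y"
  using norm_preserving_inj_on[OF assms(2) isometric_bilinearD(1)[OF assms(1,3)], of "norm x"]
    isometric_bilinearD(4)[OF assms(1,3)] assms(4) by auto

lemma orthonormal_fam_image: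
  assumes "orthonormal_fam u k Y" "subspace Y" "lin_on Y f" "\<And>y. y \<in> Y \<Longrightarrow> norm (f y) = norm y"
    "\<And>y. y \<in> Y \<Longrightarrow> f y \<in> Z"
  shows "orthonormal_fam (\<lambda>i. f (u i)) k Z"
  using assms(1) lin_on_polarize[OF assms(2,3), of 1] assms(4,5) by (auto simp: orthonormal_fam_def)

text \<open>An isometry sends an orthonormal basis of \<open>Y\<close> to an orthonormal family in
  \<open>Z\<close>. In equal dimensions this family is a basis, so the image is all of
  \<open>Z\<close>.\<close>

lemma dim_le_isometry:
  fixes f :: "'a::real_inner \<Rightarrow> 'b::real_inner"
  assumes "fd_subspace Y" "fd_subspace Z" "lin_on Y f" "\<And>y. y \<in> Y \<Longrightarrow> norm (f y) = norm y"
    "\<And>y. y \<in> Y \<Longrightarrow> f y \<in> Z"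
  shows "dim Y \<le> dim Z" and "dim Y = dim Z \<Longrightarrow> f ` Y = Z"
proof -
  note sY = fd_subspaceD[OF assms(1)]
  obtain u where u: "onb u (dim Y) Y" using onb_exists assms(1) by blast
  have o: "orthonormal_fam (\<lambda>i. f (u i)) (dim Y) Z"
    using orthonormal_fam_image[OF _ sY assms(3,4,5)] u by (simp add: onb_def)
  then show "dim Y \<le> dim Z" using orthonormal_fam_le_dim assms(2) by blast
  assume eq: "dim Y = dim Z"
  have "onb (\<lambda>i. f (u i)) (dim Y) Z" using orthonormal_fam_dim_onb assms(2) o eq by metis
  moreover have "(\<Sum>i<dim Y. c i *\<^sub>R f (u i)) \<in> f ` Y" for c
  proof -
    have uY: "u i \<in> Y" if "i < dim Y" for i using u that by (simp add: onb_def orthonormal_fam_def)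
    then have "(\<Sum>i<dim Y. c i *\<^sub>R u i) \<in> Y"
      by (intro subspace_sum[OF sY] subspace_scale[OF sY]) auto
    moreover have "f (\<Sum>i<dim Y. c i *\<^sub>R u i) = (\<Sum>i<dim Y. c i *\<^sub>R f (u i))"
      using uY by (intro lin_on_sum[OF sY assms(3)]) auto
    ultimately show ?thesis by (metis image_eqI)
  qed
  moreover have "z = (\<Sum>i<dim Y. inner z (f (u i)) *\<^sub>R f (u i))" if "onb (\<lambda>i. f (u i)) (dim Y) Z" "z \<in> Z" for z
    using that by (simp add: onb_def)
  ultimately have "Z \<subseteq> f ` Y" by (metis subsetI)
  then show "f ` Y = Z" using assms(5) by blast
qed

lemma unit_vector_exists:
  assumes "subspace X" "X \<noteq> {0}"
  obtains x where "x \<in> X" "norm x = 1"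
proof -
  obtain x where "x \<in> X" "x \<noteq> 0" using assms subspace_0 by blast
  then show ?thesis by (intro that[of "x /\<^sub>R norm x"]) (auto intro: subspace_scale[OF assms(1)])
qed

lemma isometric_bilinear_dim_le:
  assumes "fd_subspace X" "fd_subspace Y" "fd_subspace Z" "isometric_bilinear X Y Z m" "X \<noteq> {0}"
  shows "dim Y \<le> dim Z"
proof -
  obtain x where "x \<in> X" "norm x = 1" using unit_vector_exists[OF fd_subspaceD[OF assms(1)] assms(5)] by blast
  then show ?thesis
    using dim_le_isometry(1)[OF assms(2,3), of "m x"] isometric_bilinearD[OF assms(4)] by simp
qed

lemma isometric_bilinear_surj:
  assumes "fd_subspace X" "fd_subspace Y" "fd_subspace Z" "isometric_bilinear X Y Z m"
    "dim Y = dim Z" "x \<in> X" "x \<noteq> 0"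
  shows "m x ` Y = Z"
proof -
  note m = isometric_bilinearD[OF assms(4)] and sY = fd_subspaceD[OF assms(2)]
  let ?x = "x /\<^sub>R norm x"
  have x: "?x \<in> X" "norm ?x = 1" using assms by (auto intro: subspace_scale)
  \<comment> \<open>The normalising factor is moved to the other argument, so the image of
    \<open>m x\<close> contains that of \<open>m ?x\<close>.\<close>
  have eq: "m ?x y = m x (y /\<^sub>R norm x)" if "y \<in> Y" for y
    using lin_on_scaleR[OF m(2)[OF that] assms(6)] lin_on_scaleR[OF m(1)[OF assms(6)] that] by simp
  have "Z = m ?x ` Y"
    using dim_le_isometry(2)[OF assms(2,3), of "m ?x"] m x assms(5) by simp
  also have "\<dots> \<subseteq> m x ` Y" using eq subspace_scale[OF sY] by auto
  finally show ?thesis using m(3)[OF assms(6)] by auto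
qed

text \<open>For a unit vector \<open>v\<close> the second half of the action inverts
  \<open>m v\<close> up to sign, so there are isometric embeddings both ways. The Clifford
  hypothesis enters the classification in this form, as an equation of dimensions.\<close>

lemma clifford_mult_dim_eq:
  assumes "clifford_mult V S0 S1 m" "V \<noteq> {0}" "isometric_bilinear V S0 S1 m"
  shows "dim S0 = dim S1"
proof -
  obtain c where c: "graded_cl_module V S0 S1 m c" using assms by (auto simp: clifford_mult_def)
  then have fd: "fd_subspace V" "fd_subspace S0" "fd_subspace S1" by (auto simp: graded_cl_module_def)
  obtain v where v: "v \<in> V" "norm v = 1" using unit_vector_exists[OF fd_subspaceD[OF fd(1)] assms(2)] by blast
  have cS: "c v t \<in> S0" if "t \<in> S1" for t using c v that by (simp add: graded_cl_module_def)
  have mc: "m v (c v t) = - t" if "t \<in> S1" for t using c v that by (simp add: graded_cl_module_def)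
  have "norm (c v t) = norm t" if "t \<in> S1" for t
    using isometric_bilinearD(4)[OF assms(3) v(1) cS[OF that]] mc[OF that] v by simp
  moreover have "lin_on S1 (c v)" using c v by (simp add: graded_cl_module_def bilinear_on_def)
  ultimately have "dim S1 \<le> dim S0" using dim_le_isometry(1)[OF fd(3,2)] cS by blast
  moreover have "dim S0 \<le> dim S1" using isometric_bilinear_dim_le[OF fd assms(3,2)] .
  ultimately show ?thesis by simp
qed

text \<open>The missing half of the Clifford action is minus the adjoint; it has to be inverse to the
  given one up to scaling because \<open>v\<close> acts as a surjective similarity.\<close>
lemma clifford_multI:
  assumes fd: "fd_subspace V" "fd_subspace S0" "fd_subspace S1"
    and m: "isometric_bilinear V S0 S1 m" and dim: "dim S0 = dim S1"
  shows "clifford_mult V S0 S1 m"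
proof -
  note sub = fd_subspaceD[OF fd(1)] fd_subspaceD[OF fd(2)] fd_subspaceD[OF fd(3)]
  note mD = isometric_bilinearD[OF m]
  obtain u where u: "onb u (dim S0) S0" using onb_exists fd by blast
  have uS: "u i \<in> S0" if "i < dim S0" for i using u that by (simp add: onb_def orthonormal_fam_def)
  define c where "c v t = (\<Sum>i<dim S0. (- inner (m v (u i)) t) *\<^sub>R u i)" for v t
  have cS: "c v t \<in> S0" for v t
    unfolding c_def using uS by (intro subspace_sum[OF sub(2)] subspace_scale[OF sub(2)]) auto
  have c_inner: "inner s (c v t) = - inner (m v s) t" if "v \<in> V" "s \<in> S0" for v s t
  proof -
    have "inner (m v s) t = inner (m v (\<Sum>i<dim S0. inner s (u i) *\<^sub>R u i)) t"
      using u that by (simp add: onb_def)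
    also have "m v (\<Sum>i<dim S0. inner s (u i) *\<^sub>R u i) = (\<Sum>i<dim S0. inner s (u i) *\<^sub>R m v (u i))"
      using uS by (intro lin_on_sum[OF sub(2) mD(1)] that) auto
    finally show ?thesis unfolding c_def by (simp add: inner_sum_right inner_sum_left sum_negf mult.commute)
  qed
  \<comment> \<open>The defect \<open>?d\<close> lies in \<open>S0\<close>. Paired with itself, its
    two terms cancel by the adjoint relation and the similarity property of
    \<open>m v\<close>.\<close>
  have c0: "c v (m v s) = - ((norm v)\<^sup>2 *\<^sub>R s)" if "v \<in> V" "s \<in> S0" for v s
  proof -
    let ?d = "c v (m v s) + (norm v)\<^sup>2 *\<^sub>R s"
    have "?d \<in> S0" using cS that by (intro subspace_add[OF sub(2)] subspace_scale[OF sub(2)]) auto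
    moreover from this have "inner ?d ?d = 0"
      using c_inner[OF that(1), of ?d "m v s"] isometric_bilinear_inner[OF m sub(2) that(1), of ?d s] that
      by (simp add: inner_add_right)
    ultimately show ?thesis by (simp add: eq_neg_iff_add_eq_0)
  qed
  have c1: "m v (c v t) = - ((norm v)\<^sup>2 *\<^sub>R t)" if vt: "v \<in> V" "t \<in> S1" for v t
  proof (cases "v = 0")
    case True
    then show ?thesis using mD(4)[OF vt(1) cS[of v t]] by simp
  next
    case False
    then obtain s where s: "s \<in> S0" "t = m v s"
      using isometric_bilinear_surj[OF fd m dim vt(1)] vt(2) by auto
    then show ?thesis
      using c0[OF vt(1) s(1)] lin_on_scaleR[OF mD(1)[OF vt(1)] s(1), of "- (norm v)\<^sup>2"] by simp
  qed
  have "bilinear_on V S1 c"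
    unfolding bilinear_on_def lin_on_def c_def using uS
    by (simp add: lin_on_add[OF mD(2)] lin_on_scaleR[OF mD(2)] inner_simps algebra_simps
        scaleR_sum_right sum_subtractf sum_negf)
  then have "graded_cl_module V S0 S1 m c"
    unfolding graded_cl_module_def
    using fd m mD(3) cS c0 c1 c_inner by (auto simp: isometric_bilinear_def)
  then show ?thesis unfolding clifford_mult_def by blast
qed

lemma graded_cl_module_swap:
  "graded_cl_module V S0 S1 c0 c1 \<Longrightarrow> graded_cl_module V S1 S0 c1 c0"
  unfolding graded_cl_module_def by (auto simp: inner_commute)

section \<open>Spaces of similarities containing the identity\<close>

lemma subspace_inner_eqI:
  assumes "subspace Z" "a \<in> Z" "b \<in> Z" "\<And>t. t \<in> Z \<Longrightarrow> inner a t = inner b t"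
  shows "a = b"
  using assms(4)[of "a - b"] subspace_diff[OF assms(1-3)]
  by (metis inner_diff_left inner_eq_zero_iff right_minus_eq)

lemmas expand_less = orthonormal_fam_def eval_nat_numeral All_less_Suc

text \<open>Elements of \<open>C\<close> orthogonal to \<open>p0\<close> behave like imaginary
  units: they act skew-symmetrically, square to nonpositive scalars and satisfy the Clifford
  relation.\<close>

locale unital_operators =
  fixes C :: "'a::real_inner set" and Z :: "'b::real_inner set"
    and P :: "'a \<Rightarrow> 'b \<Rightarrow> 'b" and p0 :: 'a
  assumes fdC: "fd_subspace C" and fdZ: "fd_subspace Z"
    and isoP: "isometric_bilinear C Z Z P"
    and p0: "p0 \<in> C" "norm p0 = 1" and P_p0: "\<And>s. s \<in> Z \<Longrightarrow> P p0 s = s"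
    and Z_nz: "Z \<noteq> {0}"
begin

lemmas subC = fd_subspaceD[OF fdC] and subZ = fd_subspaceD[OF fdZ]
lemmas PD = isometric_bilinearD[OF isoP]
lemmas P_in = PD(3)
lemmas P_right = lin_on_add[OF PD(1)] lin_on_scaleR[OF PD(1)] lin_on_minus[OF PD(1)] lin_on_diff[OF subZ PD(1)]
lemmas P_left = lin_on_add[OF PD(2)] lin_on_scaleR[OF PD(2)] lin_on_minus[OF PD(2)] lin_on_diff[OF subC PD(2)]

lemma p0_inner: "inner p0 p0 = 1"
  using p0(2) by (simp add: norm_eq_1)

lemma P_inner_same:
  assumes "c \<in> C" "c' \<in> C" "s \<in> Z"
  shows "inner (P c s) (P c' s) = inner c c' * inner s s"
  using isometric_bilinear_inner[OF isometric_bilinear_flip[OF isoP] subC assms(3,1,2)]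
  by (simp add: power2_norm_eq_inner)

text \<open>Polarisation of \<open>|P c s| = |c| |s|\<close> in both arguments:
  \<open>P_inner_same\<close> has polarised \<open>c\<close>, and evaluation at \<open>s + t\<close>
  polarises \<open>s\<close>.\<close>

lemma P_inner_polar:
  assumes "c \<in> C" "c' \<in> C" "s \<in> Z" "t \<in> Z"
  shows "inner (P c s) (P c' t) + inner (P c' s) (P c t) = 2 * inner c c' * inner s t"
  using P_inner_same[OF assms(1,2,3)] P_inner_same[OF assms(1,2,4)]
    P_inner_same[OF assms(1,2), of "s + t"] assms subspace_add[OF subZ assms(3,4)]
  by (simp add: P_right inner_simps inner_commute algebra_simps)

text \<open>The case \<open>c' = p0\<close> of the polarised identity. The adjoint belongs to the
  conjugate of \<open>c\<close>, its reflection in the line of \<open>p0\<close>, so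
  \<open>C\<close> is closed under adjoints.\<close>

lemma P_adjoint:
  assumes "c \<in> C" "s \<in> Z" "t \<in> Z"
  shows "inner (P c s) t = inner s (P ((2 * inner c p0) *\<^sub>R p0 - c) t)"
  using P_inner_polar[OF assms(1) p0(1) assms(2,3)] assms p0
  by (simp add: P_left P_p0 inner_simps subspace_scale[OF subC])

lemma P_skew:
  assumes "c \<in> C" "inner c p0 = 0" "s \<in> Z" "t \<in> Z"
  shows "inner (P c s) t = - inner s (P c t)"
  using P_adjoint[OF assms(1,3,4)] assms by (simp add: P_left)

text \<open>The Clifford relation: in \<open>P_inner_polar\<close>, skewness moves one operator of
  each term across the inner product.\<close>

lemma P_anticommute:
  assumes "c \<in> C" "inner c p0 = 0" "c' \<in> C" "inner c' p0 = 0" "s \<in> Z"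
  shows "P c (P c' s) = - P c' (P c s) - (2 * inner c c') *\<^sub>R s"
proof (rule subspace_inner_eqI[OF subZ])
  show "P c (P c' s) \<in> Z" "- P c' (P c s) - (2 * inner c c') *\<^sub>R s \<in> Z"
    using assms by (auto intro!: P_in subspace_diff[OF subZ] subspace_neg[OF subZ] subspace_scale[OF subZ])
  fix t assume "t \<in> Z"
  then show "inner (P c (P c' s)) t = inner (- P c' (P c s) - (2 * inner c c') *\<^sub>R s) t"
    using P_inner_polar[OF assms(1,3,5), of t] P_skew[OF assms(1,2) P_in[OF assms(3,5)], of t]
      P_skew[OF assms(3,4) P_in[OF assms(1,5)], of t]
    by (simp add: inner_simps)
qed

lemma P_square:
  assumes "c \<in> C" "inner c p0 = 0" "s \<in> Z"
  shows "P c (P c s) = - (inner c c *\<^sub>R s)"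
proof (rule subspace_inner_eqI[OF subZ])
  show "P c (P c s) \<in> Z" "- (inner c c *\<^sub>R s) \<in> Z"
    using assms by (auto intro!: P_in subspace_neg[OF subZ] subspace_scale[OF subZ])
  fix t assume "t \<in> Z"
  then show "inner (P c (P c s)) t = inner (- (inner c c *\<^sub>R s)) t"
    using P_skew[OF assms(1,2) P_in[OF assms(1,3)]] isometric_bilinear_inner[OF isoP subZ assms(1,3)]
    by (simp add: power2_norm_eq_inner)
qed

lemma Z_nonzero: obtains s where "s \<in> Z" "s \<noteq> 0"
  using Z_nz subspace_0[OF subZ] by blast

text \<open>Closure is stated one-sidedly because \<open>act_product\<close> below expresses only a
  left operator composed with a right operator as a single one.\<close>

definition left_absorbs :: "'a set \<Rightarrow> bool" where
  "left_absorbs U \<longleftrightarrow> (\<forall>u\<in>U. \<forall>c\<in>C. \<exists>w\<in>C. \<forall>s\<in>Z. P u (P c s) = P w s)"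

definition right_absorbs :: "'a set \<Rightarrow> bool" where
  "right_absorbs U \<longleftrightarrow> (\<forall>u\<in>U. \<forall>c\<in>C. \<exists>w\<in>C. \<forall>s\<in>Z. P c (P u s) = P w s)"

text \<open>Both \<open>C\<close> and \<open>U\<close> are stable under adjoints, and taking adjoints reverses products.\<close>
lemma right_absorbs_imp_left:
  assumes "subspace U" "U \<subseteq> C" "p0 \<in> U" "right_absorbs U"
  shows "left_absorbs U"
  unfolding left_absorbs_def
proof (intro ballI)
  fix u c assume u: "u \<in> U" and c: "c \<in> C"
  define adj where "adj x = (2 * inner x p0) *\<^sub>R p0 - x" for x
  have adjadj: "adj (adj x) = x" for x
    unfolding adj_def by (simp add: inner_simps p0_inner algebra_simps)
  have adjU: "adj u \<in> U" unfolding adj_def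
    by (intro subspace_diff[OF assms(1)] subspace_scale[OF assms(1)] assms u)
  have adjC: "adj x \<in> C" if "x \<in> C" for x unfolding adj_def
    by (intro subspace_diff[OF subC] subspace_scale[OF subC] p0 that)
  have adj: "inner (P x s) t = inner s (P (adj x) t)" if "x \<in> C" "s \<in> Z" "t \<in> Z" for x s t
    using P_adjoint[OF that] by (simp add: adj_def)
  obtain w where w: "w \<in> C" "\<And>s. s \<in> Z \<Longrightarrow> P (adj c) (P (adj u) s) = P w s"
    using assms(4) adjU adjC[OF c] unfolding right_absorbs_def by blast
  have uC: "u \<in> C" using u assms by blast
  have "P u (P c s) = P (adj w) s" if s: "s \<in> Z" for s
  proof (rule subspace_inner_eqI[OF subZ])
    show "P u (P c s) \<in> Z" "P (adj w) s \<in> Z" using s c uC w(1) adjC P_in by blast+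
    fix t assume t: "t \<in> Z"
    have "inner (P u (P c s)) t = inner s (P (adj c) (P (adj u) t))"
      using adj[OF uC P_in[OF c s] t] adj[OF c s P_in[OF adjC[OF uC] t]] by simp
    also have "\<dots> = inner (P (adj w) s) t"
      using adj[OF adjC[OF w(1)] s t] w(2)[OF t] by (simp add: adjadj)
    finally show "inner (P u (P c s)) t = inner (P (adj w) s) t" .
  qed
  then show "\<exists>w\<in>C. \<forall>s\<in>Z. P u (P c s) = P w s" using adjC[OF w(1)] by blast
qed

text \<open>One product is enough: the rest of the multiplication table follows from the Clifford
  relation.\<close>

definition quaternionic :: "'a \<Rightarrow> 'a \<Rightarrow> 'a \<Rightarrow> bool" where
  "quaternionic I J K \<longleftrightarrow> onb ((!) [p0, I, J, K]) 4 C \<and> (\<forall>s\<in>Z. P I (P J s) = P K s)"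

text \<open>A fifth orthonormal element would anticommute with \<open>I\<close>, \<open>J\<close> and also with \<open>K = I J\<close>,
  which is impossible.\<close>
lemma absorbing_trichotomy:
  assumes U: "subspace U" "U \<subseteq> C" "p0 \<in> U" and abs: "left_absorbs U"
  shows "onb ((!) [p0]) 1 U \<or> (\<exists>I. onb ((!) [p0, I]) 2 C \<and> U = C) \<or> (\<exists>I J K. quaternionic I J K)"
proof (cases "onb ((!) [p0]) 1 U")
  case False
  have "orthonormal_fam ((!) [p0]) 1 U" using U p0_inner by (simp add: orthonormal_fam_def)
  then obtain I where I: "I \<in> U" "norm I = 1" and "\<And>i. i < 1 \<Longrightarrow> inner I ([p0] ! i) = 0"
    using onb_or_extend[OF U(1) _ False] by blast
  from this(3)[of 0] have Ip: "inner I p0 = 0" by simp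
  have IC: "I \<in> C" using I U by blast
  have II: "inner I I = 1" using I(2) by (simp add: norm_eq_1)
  show ?thesis
  proof (cases "onb ((!) [p0, I]) 2 C")
    case True
    have "C \<subseteq> U"
    proof
      fix c assume "c \<in> C"
      then have "c = (\<Sum>i<2. inner c ([p0, I] ! i) *\<^sub>R [p0, I] ! i)" using True by (simp add: onb_def)
      also have "\<dots> = inner c p0 *\<^sub>R p0 + inner c I *\<^sub>R I" by (simp add: eval_nat_numeral)
      also have "\<dots> \<in> U" using I U by (intro subspace_add[OF U(1)] subspace_scale[OF U(1)])
      finally show "c \<in> U" .
    qed
    then show ?thesis using True U by blast
  next
    case False
    have "orthonormal_fam ((!) [p0, I]) 2 C"
      using p0 IC II Ip p0_inner by (simp add: expand_less inner_commute)
    then obtain J where J: "J \<in> C" "norm J = 1" and "\<And>i. i < 2 \<Longrightarrow> inner J ([p0, I] ! i) = 0"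
      using onb_or_extend[OF subC _ False] by blast
    from this(3)[of 0] this(3)[of 1] have Jp: "inner J p0 = 0" and JI: "inner J I = 0" by simp_all
    have JJ: "inner J J = 1" using J(2) by (simp add: norm_eq_1)
    \<comment> \<open>Absorption asks only the first factor \<open>I\<close> to lie in
      \<open>U\<close>; \<open>J\<close> is an arbitrary unit of \<open>C\<close> orthogonal to
      \<open>p0\<close> and \<open>I\<close>.\<close>
    obtain K where K: "K \<in> C" and IJ: "\<And>s. s \<in> Z \<Longrightarrow> P I (P J s) = P K s"
      using abs I(1) J(1) unfolding left_absorbs_def by blast
    \<comment> \<open>By \<open>P_inner_same\<close> a single nonzero \<open>s\<close> recovers
      inner products in \<open>C\<close> from those in \<open>Z\<close>. This shows that
      \<open>K\<close> is a unit orthogonal to \<open>p0\<close>, \<open>I\<close> and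
      \<open>J\<close>.\<close>
    obtain s where s: "s \<in> Z" "s \<noteq> 0" using Z_nonzero by blast
    have Js: "P J s \<in> Z" and Is: "P I s \<in> Z" using s J IC P_in by blast+
    have KK: "inner K K = 1"
    proof -
      have "norm K * norm s = norm s"
        using IJ[OF s(1)] PD(4)[OF K s(1)] PD(4)[OF IC Js] PD(4)[OF J(1) s(1)] I(2) J(2) by simp
      then show ?thesis using s(2) by (simp add: norm_eq_1)
    qed
    have Kp: "inner K p0 = 0"
    proof -
      have "inner K p0 * inner s s = inner (P I (P J s)) s"
        using P_inner_same[OF K p0(1) s(1)] IJ[OF s(1)] P_p0[OF s(1)] by simp
      also have "\<dots> = - inner (P J s) (P I s)" by (rule P_skew[OF IC Ip Js s(1)])
      also have "\<dots> = 0" using P_inner_same[OF J(1) IC s(1)] JI by simp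
      finally show ?thesis using s(2) by simp
    qed
    have KI: "inner K I = 0"
    proof -
      have "inner K I * inner s s = inner (P I (P J s)) (P I s)"
        using P_inner_same[OF K IC s(1)] IJ[OF s(1)] by simp
      also have "\<dots> = inner (P J s) (P p0 s)"
        using isometric_bilinear_inner[OF isoP subZ IC Js s(1)] I(2) P_p0[OF s(1)] by simp
      also have "\<dots> = 0" using P_inner_same[OF J(1) p0(1) s(1)] Jp by simp
      finally show ?thesis using s(2) by simp
    qed
    have KJ: "inner K J = 0"
    proof -
      have "inner K J * inner s s = inner (P I (P J s)) (P J s)"
        using P_inner_same[OF K J(1) s(1)] IJ[OF s(1)] by simp
      also have "\<dots> = 0" using P_skew[OF IC Ip Js Js] by (simp add: inner_commute)
      finally show ?thesis using s(2) by simp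
    qed
    have on4: "orthonormal_fam ((!) [p0, I, J, K]) 4 C"
      using p0 IC J K II JJ KK Ip Jp JI Kp KI KJ p0_inner by (simp add: expand_less inner_commute)
    have "onb ((!) [p0, I, J, K]) 4 C"
    proof (rule ccontr)
      assume "\<not> ?thesis"
      then obtain L where L: "L \<in> C" "norm L = 1"
        and "\<And>i. i < 4 \<Longrightarrow> inner L ([p0, I, J, K] ! i) = 0"
        using onb_or_extend[OF subC on4] by blast
      from this(3)[of 0] this(3)[of 1] this(3)[of 2] this(3)[of 3]
      have Lo: "inner L p0 = 0" "inner L I = 0" "inner L J = 0" "inner L K = 0"
        by (simp_all add: eval_nat_numeral)
      have Ls: "P L s \<in> Z" and Ks: "P K s \<in> Z" using L s K P_in by blast+
      have "P L (P K s) = P L (P I (P J s))" using IJ s by simp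
      also have "\<dots> = - P I (P L (P J s))" using P_anticommute[OF L(1) Lo(1) IC Ip Js] Lo by simp
      also have "P L (P J s) = - P J (P L s)" using P_anticommute[OF L(1) Lo(1) J(1) Jp s(1)] Lo by simp
      also have "- P I (- P J (P L s)) = P I (P J (P L s))"
        using P_in[OF J(1) Ls] IC by (simp add: P_right)
      also have "\<dots> = P K (P L s)" using IJ Ls by simp
      finally have "P L (P K s) = P K (P L s)" .
      moreover have "P L (P K s) = - P K (P L s)"
        using P_anticommute[OF L(1) Lo(1) K Kp s(1)] Lo by simp
      ultimately have "P K (P L s) + P K (P L s) = 0" by (metis add.right_inverse)
      then have "2 *\<^sub>R P K (P L s) = 0" by (simp only: scaleR_2)
      then have "P K (P L s) = 0" by simp
      then show False
        using PD(4)[OF K Ls] PD(4)[OF L(1) s(1)] L(2) KK s(2) by (auto simp: norm_eq_1)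
    qed
    then show ?thesis using IJ unfolding quaternionic_def by blast
  qed
qed blast

end

section \<open>Complex and quaternionic multiplication in coordinates\<close>

lemma coord_cmul:
  assumes "y \<in> Cn n"
  shows "coord (cmul x y) (2 * k) = coord x 0 * coord y (2 * k) - coord x 1 * coord y (2 * k + 1)"
    and "coord (cmul x y) (2 * k + 1) = coord x 0 * coord y (2 * k + 1) + coord x 1 * coord y (2 * k)"
proof -
  let ?f = "\<lambda>i. let z = Complex (coord x 0) (coord x 1) * Complex (coord y (2 * (i div 2))) (coord y (2 * (i div 2) + 1))
     in if even i then Re z else Im z"
  have "?f i = 0" if "i \<ge> 2 * n" for i
  proof -
    have "n \<le> i div 2" using that by simp
    then show ?thesis using assms by (simp add: Let_def Cn_def coordsp_def)
  qed
  then have c: "coord (cmul x y) = ?f" unfolding cmul_def by (rule coord_Abs_fsr)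
  show "coord (cmul x y) (2 * k) = coord x 0 * coord y (2 * k) - coord x 1 * coord y (2 * k + 1)"
    "coord (cmul x y) (2 * k + 1) = coord x 0 * coord y (2 * k + 1) + coord x 1 * coord y (2 * k)"
    unfolding c by (simp_all add: Let_def)
qed

lemma coord_qmul:
  assumes "y \<in> Hn n"
  shows "coord (qmul x y) (4 * k) = coord x 0 * coord y (4 * k) - coord x 1 * coord y (4 * k + 1)
      - coord x 2 * coord y (4 * k + 2) - coord x 3 * coord y (4 * k + 3)"
    and "coord (qmul x y) (4 * k + 1) = coord x 0 * coord y (4 * k + 1) + coord x 1 * coord y (4 * k)
      + coord x 2 * coord y (4 * k + 3) - coord x 3 * coord y (4 * k + 2)"
    and "coord (qmul x y) (4 * k + 2) = coord x 0 * coord y (4 * k + 2) - coord x 1 * coord y (4 * k + 3)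
      + coord x 2 * coord y (4 * k) + coord x 3 * coord y (4 * k + 1)"
    and "coord (qmul x y) (4 * k + 3) = coord x 0 * coord y (4 * k + 3) + coord x 1 * coord y (4 * k + 2)
      - coord x 2 * coord y (4 * k + 1) + coord x 3 * coord y (4 * k)"
proof -
  let ?f = "\<lambda>i. let b = 4 * (i div 4);
         p = hmult (coord x 0, coord x 1, coord x 2, coord x 3)
                   (coord y b, coord y (b + 1), coord y (b + 2), coord y (b + 3))
     in (case p of (p0, p1, p2, p3) \<Rightarrow> [p0, p1, p2, p3] ! (i mod 4))"
  have "?f i = 0" if "i \<ge> 4 * n" for i
  proof -
    have "n \<le> i div 4" using that by simp
    then have "coord y (4 * (i div 4) + j) = 0" for j using assms by (simp add: Hn_def coordsp_def)
    from this[of 0] this[of 1] this[of 2] this[of 3]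
    have "?f i = [0, 0, 0, 0] ! (i mod 4)" by (simp add: Let_def hmult_def)
    also have "[0, 0, 0, 0] = replicate 4 (0 :: real)" by (simp add: eval_nat_numeral)
    also have "replicate 4 (0 :: real) ! (i mod 4) = 0" by (subst nth_replicate) auto
    finally show ?thesis .
  qed
  then have c: "coord (qmul x y) = ?f" unfolding qmul_def by (rule coord_Abs_fsr)
  have "(4 * k + 1) mod 4 = 1" "(4 * k + 2) mod 4 = 2" "(4 * k + 3) mod 4 = 3"
    "(4 * k + 1) div 4 = k" "(4 * k + 2) div 4 = k" "(4 * k + 3) div 4 = k"
    by presburger+
  note mods = this
  show "coord (qmul x y) (4 * k) = coord x 0 * coord y (4 * k) - coord x 1 * coord y (4 * k + 1)
      - coord x 2 * coord y (4 * k + 2) - coord x 3 * coord y (4 * k + 3)"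
    unfolding c by (simp add: Let_def hmult_def)
  show "coord (qmul x y) (4 * k + 1) = coord x 0 * coord y (4 * k + 1) + coord x 1 * coord y (4 * k)
      + coord x 2 * coord y (4 * k + 3) - coord x 3 * coord y (4 * k + 2)"
    unfolding c Let_def mods hmult_def by simp
  show "coord (qmul x y) (4 * k + 2) = coord x 0 * coord y (4 * k + 2) - coord x 1 * coord y (4 * k + 3)
      + coord x 2 * coord y (4 * k) + coord x 3 * coord y (4 * k + 1)"
    unfolding c Let_def mods hmult_def by (simp add: eval_nat_numeral)
  show "coord (qmul x y) (4 * k + 3) = coord x 0 * coord y (4 * k + 3) + coord x 1 * coord y (4 * k + 2)
      - coord x 2 * coord y (4 * k + 1) + coord x 3 * coord y (4 * k)"
    unfolding c Let_def mods hmult_def by (simp add: eval_nat_numeral)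
qed

context unital_operators
begin

text \<open>The basis of \<open>Z\<close> consists of pairs \<open>e\<close>, \<open>P I e\<close>,
  so \<open>P I\<close> acts on each pair of coordinates as multiplication by \<open>i\<close>;
  skewness of \<open>P I\<close> supplies the minus sign in the real part.\<close>

lemma complex_coordinates:
  assumes onb: "onb ((!) [p0, I]) 2 C"
  obtains n f where "n \<ge> 1" "lin_isometry f Z (Cn n)"
    "\<And>c s. c \<in> C \<Longrightarrow> s \<in> Z \<Longrightarrow> f (P c s) = cmul (coordmap ((!) [p0, I]) 2 c) (f s)"
proof -
  have "orthonormal_fam ((!) [p0, I]) 2 C" using onb by (simp add: onb_def)
  then have I: "I \<in> C" "inner I p0 = 0" "inner I I = 1" by (simp_all add: expand_less)
  define g where "g = (\<lambda>a s. P ([p0, I] ! a) s)"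
  have g: "g 0 s = s" "g 1 s = P I s" "g (Suc 0) s = P I s" if "s \<in> Z" for s using that by (simp_all add: g_def P_p0)
  have sk: "inner (P I s) t = - inner s (P I t)" if "s \<in> Z" "t \<in> Z" for s t
    using P_skew[OF I(1,2)] that by blast
  have nI: "norm (P I s) = norm s" if "s \<in> Z" for s
    using PD(4)[OF I(1) that] I(3) by (simp add: norm_eq_sqrt_inner)
  have o: "inner (P I s) s = 0" if "s \<in> Z" for s using sk[OF that that] by (simp add: inner_commute)
  have less2: "a < 2 \<longleftrightarrow> a = 0 \<or> a = 1" for a :: nat by auto
  obtain n e where e: "\<And>k. k < n \<Longrightarrow> e k \<in> Z" and b: "onb (\<lambda>i. g (i mod 2) (e (i div 2))) (2 * n) Z"
  proof (rule adapted_onb[OF fdZ, of 2 g])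
    fix a b :: nat and s assume s: "s \<in> Z"
    assume a: "a < 2"
    then show "g a s \<in> Z" "norm (g a s) = norm s" using s g nI P_in[OF I(1)] by (auto simp: less2)
    assume "b < 2" "a \<noteq> b"
    with a show "inner (g a s) (g b s) = 0" using s g o by (auto simp: less2 inner_commute)
  next
    \<comment> \<open>The adjoint of one of the operators \<open>1\<close>, \<open>I\<close> times
      another of them is again \<open>1\<close> or \<open>I\<close> up to sign.\<close>
    fix a b :: nat assume "a < 2" "b < 2"
    then consider "a = 0" "b = 0" | "a = 0" "b = 1" | "a = 1" "b = 0" | "a = 1" "b = 1" by linarith
    then show "\<exists>c<2. \<exists>\<epsilon>::real. \<forall>s\<in>Z. \<forall>t\<in>Z. inner (g b s) (g a t) = \<epsilon> * inner s (g c t)"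
    proof cases
      case 1
      then show ?thesis by (intro exI[of _ 0] conjI exI[of _ 1]) (auto simp: g)
    next
      case 2
      then show ?thesis by (intro exI[of _ 1] conjI exI[of _ "-1"]) (auto simp: g sk)
    next
      case 3
      then show ?thesis by (intro exI[of _ 1] conjI exI[of _ "1"]) (auto simp: g)
    next
      case 4
      then show ?thesis using P_square[OF I(1,2)] I P_in[OF I(1)]
        by (intro exI[of _ 0] conjI exI[of _ "1"]) (auto simp: g sk)
    qed
  qed (use g in auto)
  define w where "w = (\<lambda>i. g (i mod 2) (e (i div 2)))"
  define f where "f = coordmap w (2 * n)"
  have b: "onb w (2 * n) Z" using b by (simp add: w_def)
  have f: "lin_isometry f Z (Cn n)" unfolding f_def Cn_def by (rule lin_isometry_coordmap[OF subZ b])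
  have mult: "f (P c s) = cmul (coordmap ((!) [p0, I]) 2 c) (f s)" if c: "c \<in> C" and s: "s \<in> Z" for c s
  proof (rule fsr_eqI)
    fix i :: nat
    note co = coord_cmul[OF lin_isometryD(4)[OF f s]]
    have Pc: "P c s = inner c p0 *\<^sub>R s + inner c I *\<^sub>R P I s"
    proof -
      have "c = inner c p0 *\<^sub>R p0 + inner c I *\<^sub>R I"
        using onb c by (simp add: onb_def eval_nat_numeral)
      then have "P c s = P (inner c p0 *\<^sub>R p0 + inner c I *\<^sub>R I) s" by simp
      then show ?thesis using s p0 I by (simp add: P_left P_p0 subspace_scale[OF subC])
    qed
    have IZ: "P I s \<in> Z" using s I P_in by blast
    have wk: "w (2 * k) = e k" "w (Suc (2 * k)) = P I (e k)" if "k < n" for k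
      using e[OF that] g by (simp_all add: w_def)
    consider k where "k < n" "i = 2 * k" | k where "k < n" "i = 2 * k + 1" | k where "k \<ge> n" "i = 2 * k \<or> i = 2 * k + 1"
      by (metis add.right_neutral linorder_not_le mod_mult_div_eq not_mod_2_eq_1_eq_0 parity_cases even_two_times_div_two odd_two_times_div_two_succ)
    then show "coord (f (P c s)) i = coord (cmul (coordmap ((!) [p0, I]) 2 c) (f s)) i"
    proof cases
      case 1
      then show ?thesis unfolding 1(2) co using wk[OF 1(1)] s e[OF 1(1)]
        by (simp add: f_def Pc inner_simps sk)
    next
      case 2
      then show ?thesis unfolding 2(2) co using wk[OF 2(1)] s e[OF 2(1)] IZ I P_square[OF I(1,2)]
          P_in[OF I(1)]
        by (simp add: f_def Pc inner_simps sk)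
    next
      case 3
      then show ?thesis using co[of _ k] by (auto simp: f_def)
    qed
  qed
  have "n \<noteq> 0"
  proof
    assume "n = 0"
    then have "f ` Z = {0}" using lin_isometryD(3)[OF f] by (auto simp: Cn_def coordsp_def intro: fsr_eqI)
    then show False using lin_isometryD(5)[OF f] Z_nonzero by (metis image_eqI norm_eq_zero singletonD)
  qed
  then show ?thesis using that[OF _ f mult] by simp
qed

text \<open>Here the blocks are \<open>e\<close>, \<open>P I e\<close>, \<open>P J e\<close>,
  \<open>P K e\<close>. Pairing \<open>P c s\<close> with a block and moving operators by skewness
  reproduces left Hamilton multiplication, signs included.\<close>

lemma quaternionic_coordinates:
  assumes q: "quaternionic I J K"
  obtains n f where "n \<ge> 1" "lin_isometry f Z (Hn n)"
    "\<And>c s. c \<in> C \<Longrightarrow> s \<in> Z \<Longrightarrow> f (P c s) = qmul (coordmap ((!) [p0, I, J, K]) 4 c) (f s)"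
proof -
  have onb: "onb ((!) [p0, I, J, K]) 4 C" and IJ: "\<And>s. s \<in> Z \<Longrightarrow> P I (P J s) = P K s"
    using q by (simp_all add: quaternionic_def)
  have "orthonormal_fam ((!) [p0, I, J, K]) 4 C" using onb by (simp add: onb_def)
  then have C: "I \<in> C" "J \<in> C" "K \<in> C"
    and p: "inner I p0 = 0" "inner J p0 = 0" "inner K p0 = 0"
    and n: "inner I I = 1" "inner J J = 1" "inner K K = 1"
    and o: "inner I J = 0" "inner I K = 0" "inner J K = 0"
    by (simp_all add: expand_less inner_commute)
  have Z: "P I s \<in> Z" "P J s \<in> Z" "P K s \<in> Z" if "s \<in> Z" for s using that C P_in by blast+
  have sq: "P I (P I s) = - s" "P J (P J s) = - s" "P K (P K s) = - s" if "s \<in> Z" for s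
    using P_square[OF C(1) p(1) that] P_square[OF C(2) p(2) that] P_square[OF C(3) p(3) that] n by simp_all
  have neg: "P I (- s) = - P I s" "P J (- s) = - P J s" "P K (- s) = - P K s" if "s \<in> Z" for s
    using that C by (simp_all add: P_right)
  \<comment> \<open>Hamilton's table from \<open>I J = K\<close>: squares yield \<open>I K\<close>
    and \<open>K J\<close>, anticommutation yields the reversed products.\<close>
  have JI: "P J (P I s) = - P K s" if "s \<in> Z" for s
    using P_anticommute[OF C(2) p(2) C(1) p(1) that] o IJ[OF that] by (simp add: inner_commute)
  have IK: "P I (P K s) = - P J s" if "s \<in> Z" for s
    using sq(1)[OF Z(2)[OF that]] IJ[OF that] by simp
  have KI: "P K (P I s) = P J s" if "s \<in> Z" for s
    using P_anticommute[OF C(3) p(3) C(1) p(1) that] o IK[OF that] by (simp add: inner_commute)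
  have KJ: "P K (P J s) = - P I s" if "s \<in> Z" for s
    using IJ[OF Z(2)[OF that]] sq(2)[OF that] neg(1)[OF that] by simp
  have JK: "P J (P K s) = P I s" if "s \<in> Z" for s
    using P_anticommute[OF C(2) p(2) C(3) p(3) that] o KJ[OF that] by simp
  have sk: "inner (P I s) t = - inner s (P I t)" "inner (P J s) t = - inner s (P J t)"
    "inner (P K s) t = - inner s (P K t)" if "s \<in> Z" "t \<in> Z" for s t
    using P_skew C p that by blast+
  have nm: "norm (P I s) = norm s" "norm (P J s) = norm s" "norm (P K s) = norm s" if "s \<in> Z" for s
    using PD(4)[OF C(1) that] PD(4)[OF C(2) that] PD(4)[OF C(3) that] n by (simp_all add: norm_eq_sqrt_inner)
  note tab = sq IJ JI IK KI KJ JK sk Z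
  define g where "g = (\<lambda>a s. P ([p0, I, J, K] ! a) s)"
  have g: "g 0 s = s" "g 1 s = P I s" "g (Suc 0) s = P I s" "g 2 s = P J s" "g 3 s = P K s" if "s \<in> Z" for s
    using that by (simp_all add: g_def P_p0 eval_nat_numeral)
  have less4: "a < 4 \<longleftrightarrow> a = 0 \<or> a = 1 \<or> a = 2 \<or> a = 3" for a :: nat by auto
  obtain n e where e: "\<And>k. k < n \<Longrightarrow> e k \<in> Z" and b: "onb (\<lambda>i. g (i mod 4) (e (i div 4))) (4 * n) Z"
  proof (rule adapted_onb[OF fdZ, of 4 g])
    fix a b :: nat and s assume s: "s \<in> Z"
    assume a: "a < 4"
    then show "g a s \<in> Z" "norm (g a s) = norm s" using s g nm Z by (auto simp: less4)
    assume "b < 4" "a \<noteq> b"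
    with a show "inner (g a s) (g b s) = 0"
      using s g P_inner_same[of "[p0, I, J, K] ! a" "[p0, I, J, K] ! b" s] C p0 p o
      unfolding g_def by (auto simp: less4 inner_commute)
  next
    fix a b :: nat assume ab: "a < 4" "b < 4"
    \<comment> \<open>The adjoint of one basis operator times another is a signed basis operator. In
      each of the sixteen cases its index and sign are found by trying all eight candidates.\<close>
    have pos: "\<exists>c<4. \<exists>\<epsilon>::real. \<forall>s\<in>Z. \<forall>t\<in>Z. inner (g b s) (g a t) = \<epsilon> * inner s (g c t)"
      if "c < 4" "\<epsilon> = 1 \<or> \<epsilon> = -1" "\<And>s t. s \<in> Z \<Longrightarrow> t \<in> Z \<Longrightarrow> inner (g b s) (g a t) = \<epsilon> * inner s (g c t)" for c and \<epsilon> :: real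
      using that by blast
    from ab[unfolded less4]
    show "\<exists>c<4. \<exists>\<epsilon>::real. \<forall>s\<in>Z. \<forall>t\<in>Z. inner (g b s) (g a t) = \<epsilon> * inner s (g c t)"
    proof (elim disjE)
    qed (((rule pos[of 0 "1"]; simp add: g tab; fail) |
            (rule pos[of 0 "-1"]; simp add: g tab; fail) |
            (rule pos[of 1 "1"]; simp add: g tab; fail) |
            (rule pos[of 1 "-1"]; simp add: g tab; fail) |
            (rule pos[of 2 "1"]; simp add: g tab; fail) |
            (rule pos[of 2 "-1"]; simp add: g tab; fail) |
            (rule pos[of 3 "1"]; simp add: g tab; fail) |
            (rule pos[of 3 "-1"]; simp add: g tab; fail))+)
  qed (use g in auto)
  define w where "w = (\<lambda>i. g (i mod 4) (e (i div 4)))"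
  define f where "f = coordmap w (4 * n)"
  have b: "onb w (4 * n) Z" using b by (simp add: w_def)
  have f: "lin_isometry f Z (Hn n)" unfolding f_def Hn_def by (rule lin_isometry_coordmap[OF subZ b])
  have mult: "f (P c s) = qmul (coordmap ((!) [p0, I, J, K]) 4 c) (f s)" if c: "c \<in> C" and s: "s \<in> Z" for c s
  proof (rule fsr_eqI)
    fix i :: nat
    note co = coord_qmul[OF lin_isometryD(4)[OF f s]]
    have Pc: "P c s = inner c p0 *\<^sub>R s + inner c I *\<^sub>R P I s + inner c J *\<^sub>R P J s + inner c K *\<^sub>R P K s"
    proof -
      have "c = inner c p0 *\<^sub>R p0 + inner c I *\<^sub>R I + inner c J *\<^sub>R J + inner c K *\<^sub>R K"
        using onb c by (simp add: onb_def eval_nat_numeral)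
      then have "P c s = P (inner c p0 *\<^sub>R p0 + inner c I *\<^sub>R I + inner c J *\<^sub>R J + inner c K *\<^sub>R K) s" by simp
      then show ?thesis using s p0 C by (simp add: P_left P_p0 subspace_scale[OF subC] subspace_add[OF subC])
    qed
    define k where "k = i div 4"
    have ik: "i = 4 * k \<or> i = 4 * k + 1 \<or> i = 4 * k + 2 \<or> i = 4 * k + 3" unfolding k_def by presburger
    have md: "(4 * k + 1) mod 4 = 1" "(4 * k + 2) mod 4 = 2" "(4 * k + 3) mod 4 = 3"
      "(4 * k + 1) div 4 = k" "(4 * k + 2) div 4 = k" "(4 * k + 3) div 4 = k"
      by presburger+
    have u: "[p0, I, J, K] ! 1 = I" "[p0, I, J, K] ! 2 = J" "[p0, I, J, K] ! 3 = K" by (simp_all add: eval_nat_numeral)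
    show "coord (f (P c s)) i = coord (qmul (coordmap ((!) [p0, I, J, K]) 4 c) (f s)) i"
    proof (cases "k < n")
      case True
      note ek = e[OF True]
      have wk: "w (4 * k) = e k" "w (4 * k + 1) = P I (e k)" "w (4 * k + 2) = P J (e k)" "w (4 * k + 3) = P K (e k)"
        unfolding w_def md using ek g by simp_all
      have lt: "4 * k < 4 * n" "4 * k + 1 < 4 * n" "4 * k + 2 < 4 * n" "4 * k + 3 < 4 * n" using True by auto
      have fc: "coord (f z) (4 * k) = inner z (e k)" "coord (f z) (4 * k + 1) = inner z (P I (e k))"
        "coord (f z) (4 * k + 2) = inner z (P J (e k))" "coord (f z) (4 * k + 3) = inner z (P K (e k))" for z
        unfolding f_def coord_coordmap wk using lt by simp_all
      have cc: "coord (coordmap ((!) [p0, I, J, K]) 4 c) 0 = inner c p0" "coord (coordmap ((!) [p0, I, J, K]) 4 c) 1 = inner c I"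
        "coord (coordmap ((!) [p0, I, J, K]) 4 c) 2 = inner c J" "coord (coordmap ((!) [p0, I, J, K]) 4 c) 3 = inner c K"
        unfolding coord_coordmap u by simp_all
      from ik show ?thesis
      proof (elim disjE)
        assume i: "i = 4 * k"
        show ?thesis unfolding i co fc cc Pc using s ek by (simp add: inner_simps tab)
      next
        assume i: "i = 4 * k + 1"
        show ?thesis unfolding i co fc cc Pc using s ek by (simp add: inner_simps tab)
      next
        assume i: "i = 4 * k + 2"
        show ?thesis unfolding i co fc cc Pc using s ek by (simp add: inner_simps tab)
      next
        assume i: "i = 4 * k + 3"
        show ?thesis unfolding i co fc cc Pc using s ek by (simp add: inner_simps tab)
      qed
    next
      case False
      then have "coord (f z) (4 * k + j) = 0" for z j by (simp add: f_def)
      from this[of _ 0] this[of _ 1] this[of _ 2] this[of _ 3]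
      show ?thesis using ik co[of _ k] by auto
    qed
  qed
  have "n \<noteq> 0"
  proof
    assume "n = 0"
    then have "f ` Z = {0}" using lin_isometryD(3)[OF f] by (auto simp: Hn_def coordsp_def intro: fsr_eqI)
    then show False using lin_isometryD(5)[OF f] Z_nonzero by (metis image_eqI norm_eq_zero singletonD)
  qed
  then show ?thesis using that[OF _ f mult] by simp
qed

end

section \<open>Algebras acting from the left\<close>

lemma onb_cong: "(\<And>i. i < m \<Longrightarrow> u i = v i) \<Longrightarrow> onb u m Z \<longleftrightarrow> onb v m Z"
  by (simp add: onb_def orthonormal_fam_def)

text \<open>Inner products are preserved and \<open>f\<close> is injective, so expansions pull back.
  Later this turns a basis of \<open>left_ops\<close> or \<open>right_ops\<close> into one of
  \<open>N12\<close> or \<open>N23\<close>.\<close>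

lemma onb_isometry_pullback:
  fixes f :: "'a::real_inner \<Rightarrow> 'b::real_inner"
  assumes X: "subspace X" and f: "lin_on X f" "\<And>x. x \<in> X \<Longrightarrow> norm (f x) = norm x"
    and u: "\<And>i. i < m \<Longrightarrow> u i \<in> X" and b: "onb (\<lambda>i. f (u i)) m (f ` X)"
  shows "onb u m X"
proof -
  have ip: "inner (f x) (f y) = inner x y" if "x \<in> X" "y \<in> X" for x y
    using lin_on_polarize[OF X f(1), of 1 x y] f(2) that by simp
  have "orthonormal_fam u m X"
    using b u ip unfolding onb_def orthonormal_fam_def by simp
  moreover have "z = (\<Sum>i<m. inner z (u i) *\<^sub>R u i)" if z: "z \<in> X" for z
  proof -
    have "f z = (\<Sum>i<m. inner (f z) (f (u i)) *\<^sub>R f (u i))" using b z unfolding onb_def by blast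
    also have "\<dots> = (\<Sum>i<m. inner z (u i) *\<^sub>R f (u i))" using z u ip by simp
    also have "\<dots> = f (\<Sum>i<m. inner z (u i) *\<^sub>R u i)" using u by (intro lin_on_sum[OF X f(1), symmetric]) auto
    finally show ?thesis
      using norm_preserving_inj_on[OF X f(1), of 1] f(2) z
        subspace_sum[OF X, of "{..<m}" "\<lambda>i. inner z (u i) *\<^sub>R u i"] u subspace_scale[OF X]
      by (simp add: inj_on_def)
  qed
  ultimately show ?thesis unfolding onb_def by blast
qed

abbreviation alg4 where
  "alg4 N12 N13 N14 N23 N24 N34 m123 m124 m134 m234 \<equiv>
     \<lparr> Sp = sp4 N12 N13 N14 N23 N24 N34, Mu = mu4 m123 m124 m134 m234 \<rparr>"

lemma pairs_le_4:
  "1 \<le> i \<and> i < j \<and> j \<le> (4::nat) \<longleftrightarrow> i = 1 \<and> j = 2 \<or> i = 1 \<and> j = 3 \<or> i = 1 \<and> j = 4 \<or>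
     i = 2 \<and> j = 3 \<or> i = 2 \<and> j = 4 \<or> i = 3 \<and> j = 4"
  by auto

lemma triples_le_4:
  "1 \<le> i \<and> i < j \<and> j < k \<and> k \<le> (4::nat) \<longleftrightarrow> i = 1 \<and> j = 2 \<and> k = 3 \<or> i = 1 \<and> j = 2 \<and> k = 4 \<or>
     i = 1 \<and> j = 3 \<and> k = 4 \<or> i = 2 \<and> j = 3 \<and> k = 4"
  by auto

lemma qn_iso_alg4I:
  fixes f12 f13 f14 f23 f24 f34 :: "'v::real_inner \<Rightarrow> 'w::real_inner"
  assumes "lin_isometry f12 N12 M12" "lin_isometry f13 N13 M13" "lin_isometry f14 N14 M14"
    "lin_isometry f23 N23 M23" "lin_isometry f24 N24 M24" "lin_isometry f34 N34 M34"
    and "\<And>x y. x \<in> N12 \<Longrightarrow> y \<in> N23 \<Longrightarrow> f13 (m123 x y) = n123 (f12 x) (f23 y)"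
    and "\<And>x y. x \<in> N12 \<Longrightarrow> y \<in> N24 \<Longrightarrow> f14 (m124 x y) = n124 (f12 x) (f24 y)"
    and "\<And>x y. x \<in> N13 \<Longrightarrow> y \<in> N34 \<Longrightarrow> f14 (m134 x y) = n134 (f13 x) (f34 y)"
    and "\<And>x y. x \<in> N23 \<Longrightarrow> y \<in> N34 \<Longrightarrow> f24 (m234 x y) = n234 (f23 x) (f34 y)"
  shows "qn_iso 4 (alg4 N12 N13 N14 N23 N24 N34 m123 m124 m134 m234)
    (alg4 M12 M13 M14 M23 M24 M34 n123 n124 n134 n234)"
proof -
  define \<phi> where "\<phi> i j = (if i = 1 \<and> j = 2 then f12 else if i = 1 \<and> j = 3 then f13
      else if i = 1 \<and> j = 4 then f14 else if i = 2 \<and> j = 3 then f23 else if i = 2 \<and> j = 4 then f24 else f34)"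
    for i j :: nat
  show ?thesis
    unfolding qn_iso_def pairs_le_4 triples_le_4 lin_isometry_def[symmetric]
    by (rule exI[of _ \<phi>]) (use assms in \<open>auto simp: \<phi>_def sp4_def mu4_def\<close>)
qed

text \<open>The case in which \<open>N12\<close>, \<open>N13\<close> and \<open>N23\<close> all act from the left by bijections between
  \<open>N34\<close>, \<open>N24\<close> and \<open>N14\<close>. The unit vectors \<open>x0\<close>, \<open>y0\<close> and \<open>p0 = x0 y0\<close> identify these three
  spaces, and \<open>N13\<close> becomes a space of operators \<open>act c\<close> on \<open>N34\<close> containing the identity.\<close>
locale left_chain =
  fixes N12 N13 N14 N23 N24 N34 :: "'v::real_inner set" and m123 m124 m134 m234 :: "'v \<Rightarrow> 'v \<Rightarrow> 'v"
    and x0 y0 :: 'v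
  assumes fd: "fd_subspace N12" "fd_subspace N13" "fd_subspace N14" "fd_subspace N23" "fd_subspace N24"
      "fd_subspace N34"
    and iso123: "isometric_bilinear N12 N23 N13 m123" and iso124: "isometric_bilinear N12 N24 N14 m124"
    and iso134: "isometric_bilinear N13 N34 N14 m134" and iso234: "isometric_bilinear N23 N34 N24 m234"
    and assoc: "\<And>x y z. x \<in> N12 \<Longrightarrow> y \<in> N23 \<Longrightarrow> z \<in> N34 \<Longrightarrow> m134 (m123 x y) z = m124 x (m234 y z)"
    and N34_nz: "N34 \<noteq> {0}"
    and dims: "dim N34 = dim N14" "dim N34 = dim N24"
    and x0: "x0 \<in> N12" "norm x0 = 1" and y0: "y0 \<in> N23" "norm y0 = 1"
begin

lemmas sub = fd[THEN fd_subspaceD]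
lemmas D123 = isometric_bilinearD[OF iso123] and D124 = isometric_bilinearD[OF iso124]
  and D134 = isometric_bilinearD[OF iso134] and D234 = isometric_bilinearD[OF iso234]

definition p0 :: 'v where "p0 = m123 x0 y0"
definition act :: "'v \<Rightarrow> 'v \<Rightarrow> 'v" where "act c s = inv_into N34 (m134 p0) (m134 c s)"

lemma p0_in: "p0 \<in> N13" "norm p0 = 1"
  using D123(3,4)[OF x0(1) y0(1)] x0 y0 by (simp_all add: p0_def)

lemma unit_surj:
  assumes "isometric_bilinear X Y Z m" "fd_subspace X" "fd_subspace Y" "fd_subspace Z" "dim Y = dim Z"
    "x \<in> X" "norm x = 1"
  shows "lin_isometry (m x) Y Z"
proof (rule lin_isometryI)
  have "x \<noteq> 0" using assms(7) by auto
  then show "m x ` Y = Z" using isometric_bilinear_surj[OF assms(2,3,4,1,5,6)] by blast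
qed (use assms isometric_bilinearD[OF assms(1)] in auto)

lemma iso_p0: "lin_isometry (m134 p0) N34 N14"
  by (rule unit_surj[OF iso134 fd(2,6,3) dims(1) p0_in])

lemma iso_y0: "lin_isometry (m234 y0) N34 N24"
  by (rule unit_surj[OF iso234 fd(4,6,5) dims(2) y0])

lemma iso_p0_inv: "lin_isometry (inv_into N34 (m134 p0)) N14 N34"
  by (rule lin_isometry_inv[OF sub(6) iso_p0])

lemma iso_y0_inv: "lin_isometry (inv_into N34 (m234 y0)) N24 N34"
  by (rule lin_isometry_inv[OF sub(6) iso_y0])

lemma isometric_act: "isometric_bilinear N13 N34 N34 act"
  unfolding isometric_bilinear_def bilinear_on_def lin_on_def act_def
  using D134 lin_isometryD[OF iso_p0_inv]
  by (auto simp: lin_on_add[OF D134(1)] lin_on_add[OF D134(2)] lin_on_scaleR[OF D134(1)]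
      lin_on_scaleR[OF D134(2)] lin_on_add[OF lin_isometryD(1)[OF iso_p0_inv]]
      lin_on_scaleR[OF lin_isometryD(1)[OF iso_p0_inv]])

sublocale unital_operators N13 N34 act p0
proof
  show "act p0 s = s" if "s \<in> N34" for s
    using lin_isometryD(6)[OF iso_p0 that] by (simp add: act_def)
qed (use fd isometric_act p0_in N34_nz in auto)

lemma m134_act: "c \<in> N13 \<Longrightarrow> s \<in> N34 \<Longrightarrow> m134 p0 (act c s) = m134 c s"
  using lin_isometryD(8)[OF iso_p0 D134(3)] by (simp add: act_def)

text \<open>Once \<open>y0\<close> identifies \<open>N34\<close> with \<open>N24\<close>, an element
  \<open>y\<close> acts as the operator of \<open>x0 y\<close>. Associativity shows this after
  applying \<open>m124 x0\<close>, which is injective.\<close>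

lemma m234_act:
  assumes "y \<in> N23" "s \<in> N34"
  shows "m234 y0 (act (m123 x0 y) s) = m234 y s"
proof -
  have "m123 x0 y \<in> N13" using D123(3) x0 assms by blast
  then have a: "act (m123 x0 y) s \<in> N34" "m134 p0 (act (m123 x0 y) s) = m134 (m123 x0 y) s"
    using P_in m134_act assms by blast+
  then have "m124 x0 (m234 y0 (act (m123 x0 y) s)) = m124 x0 (m234 y s)"
    using assoc[OF x0(1) y0(1) a(1)] assoc[OF x0(1) assms] by (simp add: p0_def)
  moreover have "inj_on (m124 x0) N24"
    using isometric_bilinear_inj[OF iso124 sub(5) x0(1)] x0(2) by fastforce
  ultimately show ?thesis
    using D234(3)[OF y0(1) a(1)] D234(3)[OF assms] by (simp add: inj_on_def)
qed

lemma m124_act: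
  assumes "x \<in> N12" "s \<in> N34"
  shows "m124 x (m234 y0 s) = m134 p0 (act (m123 x y0) s)"
  using assoc[OF assms(1) y0(1) assms(2)] m134_act[OF D123(3)[OF assms(1) y0(1)] assms(2)] by simp

text \<open>The product of the algebra becomes composition: \<open>x\<close> acts as
  \<open>x y0\<close> and \<open>y\<close> as \<open>x0 y\<close>. Both sides are compared after the
  injective map \<open>m134 p0\<close>.\<close>

lemma act_product:
  assumes "x \<in> N12" "y \<in> N23" "s \<in> N34"
  shows "act (m123 x y) s = act (m123 x y0) (act (m123 x0 y) s)"
proof -
  have in13: "m123 x y \<in> N13" "m123 x y0 \<in> N13" "m123 x0 y \<in> N13"
    using D123(3) assms x0 y0 by blast+
  have s': "act (m123 x0 y) s \<in> N34" using P_in in13 assms by blast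
  have "m134 p0 (act (m123 x y0) (act (m123 x0 y) s)) = m134 p0 (act (m123 x y) s)"
    using m124_act[OF assms(1) s'] m234_act[OF assms(2,3)] assoc[OF assms] m134_act[OF in13(1) assms(3)] by simp
  then show ?thesis
    using lin_isometryD(2)[OF iso_p0] P_in[OF in13(2) s'] P_in[OF in13(1) assms(3)] by (simp add: inj_on_def)
qed

text \<open>Isometric copies of \<open>N12\<close> and \<open>N23\<close> inside the operator space
  \<open>N13\<close>; both contain \<open>p0 = x0 y0\<close>, the identity operator.\<close>

definition left_ops :: "'v set" where "left_ops = (\<lambda>x. m123 x y0) ` N12"
definition right_ops :: "'v set" where "right_ops = m123 x0 ` N23"

lemma ops_facts:
  "subspace left_ops" "left_ops \<subseteq> N13" "p0 \<in> left_ops"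
  "subspace right_ops" "right_ops \<subseteq> N13" "p0 \<in> right_ops"
  unfolding left_ops_def right_ops_def
  using subspace_lin_image[OF sub(1) D123(2)[OF y0(1)]] subspace_lin_image[OF sub(4) D123(1)[OF x0(1)]]
    D123(3) x0 y0 by (auto simp: p0_def)

lemma iso_left_ops: "lin_isometry (\<lambda>x. m123 x y0) N12 left_ops"
  by (rule lin_isometryI) (use D123 sub y0 in \<open>auto simp: left_ops_def\<close>)

lemma iso_right_ops: "lin_isometry (m123 x0) N23 right_ops"
  by (rule lin_isometryI) (use D123 sub x0 in \<open>auto simp: right_ops_def\<close>)

section \<open>Isomorphisms with the model algebras\<close>

lemma lin_isometry_restrict:
  assumes "lin_isometry f X Y" "U \<subseteq> X"
  shows "lin_isometry f U (f ` U)"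
  using assms unfolding lin_isometry_def lin_on_def
  by (auto simp: subset_iff intro: bij_betw_subset)

text \<open>The isometries on \<open>N14\<close> and \<open>N24\<close> are obtained from
  \<open>f34\<close> through the identifications by \<open>p0\<close> and \<open>y0\<close>; only
  four isometries remain to be chosen.\<close>

lemma assemble:
  assumes f12: "lin_isometry f12 N12 X1" and f13: "lin_isometry f13 N13 C1"
    and f23: "lin_isometry f23 N23 Y1" and f34: "lin_isometry f34 N34 Z1"
    and n123: "\<And>x y. x \<in> N12 \<Longrightarrow> y \<in> N23 \<Longrightarrow> f13 (m123 x y) = n123 (f12 x) (f23 y)"
    and n124: "\<And>x s. x \<in> N12 \<Longrightarrow> s \<in> N34 \<Longrightarrow> f34 (act (m123 x y0) s) = n124 (f12 x) (f34 s)"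
    and n134: "\<And>c s. c \<in> N13 \<Longrightarrow> s \<in> N34 \<Longrightarrow> f34 (act c s) = n134 (f13 c) (f34 s)"
    and n234: "\<And>y s. y \<in> N23 \<Longrightarrow> s \<in> N34 \<Longrightarrow> f34 (act (m123 x0 y) s) = n234 (f23 y) (f34 s)"
  shows "qn_iso 4 (alg4 N12 N13 N14 N23 N24 N34 m123 m124 m134 m234)
    (alg4 X1 C1 Z1 Y1 Z1 Z1 n123 n124 n134 n234)"
proof (rule qn_iso_alg4I[OF f12 f13 lin_isometry_comp[OF iso_p0_inv f34] f23
      lin_isometry_comp[OF iso_y0_inv f34] f34])
  note ip = lin_isometryD(6)[OF iso_p0] and iy = lin_isometryD(6)[OF iso_y0]
  fix x w assume x: "x \<in> N12" and w: "w \<in> N24"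
  define s where "s = inv_into N34 (m234 y0) w"
  have s: "s \<in> N34" "w = m234 y0 s"
    using lin_isometryD(7,8)[OF iso_y0 w] by (simp_all add: s_def)
  show "f34 (inv_into N34 (m134 p0) (m124 x w)) = n124 (f12 x) (f34 (inv_into N34 (m234 y0) w))"
    using m124_act[OF x s(1)] n124[OF x s(1)] ip[OF P_in[OF D123(3)[OF x y0(1)] s(1)]] s iy[OF s(1)]
    by (simp add: s_def[symmetric])
next
  fix c s assume cs: "c \<in> N13" "s \<in> N34"
  show "f34 (inv_into N34 (m134 p0) (m134 c s)) = n134 (f13 c) (f34 s)"
    using n134[OF cs] by (simp add: act_def)
next
  fix y s assume ys: "y \<in> N23" "s \<in> N34"
  show "f34 (inv_into N34 (m234 y0) (m234 y s)) = n234 (f23 y) (f34 s)"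
    using n234[OF ys] m234_act[OF ys] lin_isometryD(6)[OF iso_y0 P_in[OF D123(3)[OF x0(1) ys(1)] ys(2)]]
    by simp
qed (rule n123)

text \<open>In the applications \<open>e\<close> is the first unit vector of \<open>Cn n\<close> or
  \<open>Hn n\<close>, and \<open>Cn 1\<close> or \<open>Hn 1\<close> sits there as the first block.
  Evaluating \<open>act_product\<close> at the preimage of \<open>e\<close> gives multiplicativity
  of \<open>f13\<close>.\<close>

lemma assemble_multiplication:
  assumes f13: "lin_isometry f13 N13 C1" and f34: "lin_isometry f34 N34 Z1"
    and mul: "\<And>c s. c \<in> N13 \<Longrightarrow> s \<in> N34 \<Longrightarrow> f34 (act c s) = mul (f13 c) (f34 s)"
    and e: "e \<in> Z1" "\<And>a. a \<in> C1 \<Longrightarrow> mul a e = a"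
  shows "qn_iso 4 (alg4 N12 N13 N14 N23 N24 N34 m123 m124 m134 m234)
    (alg4 (f13 ` left_ops) C1 Z1 (f13 ` right_ops) Z1 Z1 mul mul mul mul)"
proof (rule assemble[OF lin_isometry_comp[OF iso_left_ops lin_isometry_restrict[OF f13 ops_facts(2)]] f13
      lin_isometry_comp[OF iso_right_ops lin_isometry_restrict[OF f13 ops_facts(5)]] f34 _ _ mul])
  fix x y assume xy: "x \<in> N12" "y \<in> N23"
  have in13: "m123 x y \<in> N13" "m123 x y0 \<in> N13" "m123 x0 y \<in> N13"
    using D123(3) xy x0 y0 by blast+
  define s where "s = inv_into N34 f34 e"
  have s: "s \<in> N34" "f34 s = e" using lin_isometryD(7,8)[OF f34 e(1)] by (simp_all add: s_def)
  have "f13 (m123 x y) = f34 (act (m123 x y) s)"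
    using mul[OF in13(1) s(1)] e(2) lin_isometryD(4)[OF f13 in13(1)] s by simp
  also have "\<dots> = mul (f13 (m123 x y0)) (f13 (m123 x0 y))"
    using act_product[OF xy s(1)] mul[OF in13(2) P_in[OF in13(3) s(1)]] mul[OF in13(3) s(1)] s
      e(2)[OF lin_isometryD(4)[OF f13 in13(3)]] by simp
  finally show "f13 (m123 x y) = mul (f13 (m123 x y0)) (f13 (m123 x0 y))" .
next
  show "f34 (act (m123 x y0) s) = mul (f13 (m123 x y0)) (f34 s)" if "x \<in> N12" "s \<in> N34" for x s
    using mul D123(3) that y0 by blast
  show "f34 (act (m123 x0 y) s) = mul (f13 (m123 x0 y)) (f34 s)" if "y \<in> N23" "s \<in> N34" for y s
    using mul D123(3) that x0 by blast
qed

lemma image_ops_nonzero: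
  assumes "lin_isometry f N13 C1" "p0 \<in> U"
  shows "f ` U \<noteq> {0}"
proof
  assume "f ` U = {0}"
  then have "f p0 = 0" using assms(2) by blast
  then show False using lin_isometryD(5)[OF assms(1) p0_in(1)] p0_in(2) by simp
qed

lemma assemble_complex:
  assumes b: "onb ((!) [p0, I]) 2 N13" and full: "left_ops = N13" "right_ops = N13"
  shows "\<exists>M\<in>N3_family. qn_iso 4 (alg4 N12 N13 N14 N23 N24 N34 m123 m124 m134 m234) M"
proof -
  obtain n f where n: "n \<ge> 1" and f: "lin_isometry f N34 (Cn n)"
    and mul: "\<And>c s. c \<in> N13 \<Longrightarrow> s \<in> N34 \<Longrightarrow> f (act c s) = cmul (coordmap ((!) [p0, I]) 2 c) (f s)"
    using complex_coordinates[OF b] by metis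
  have f13: "lin_isometry (coordmap ((!) [p0, I]) 2) N13 (Cn 1)"
    using lin_isometry_coordmap[OF sub(2) b] by (simp add: Cn_def)
  have e: "fsr_unit 0 \<in> Cn n" using n by (auto simp: Cn_def coordsp_def)
  have unit: "cmul a (fsr_unit 0) = a" if a: "a \<in> Cn 1" for a
  proof (rule fsr_eqI)
    fix i :: nat
    have "i = 2 * (i div 2) \<or> i = 2 * (i div 2) + 1" by presburger
    moreover have "i div 2 = 0 \<or> i div 2 \<ge> 1" by linarith
    ultimately show "coord (cmul a (fsr_unit 0)) i = coord a i"
      using coord_cmul[OF e, of a "i div 2"] a by (auto simp: Cn_def coordsp_def)
  qed
  show ?thesis
    using assemble_multiplication[OF f13 f mul e unit] n full lin_isometryD(3)[OF f13]
    by (auto simp: N3_family_def N3_def)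
qed

lemma quaternionic_iso:
  assumes q: "quaternionic I J K"
  obtains f n where "n \<ge> 1" "lin_isometry f N13 (Hn 1)"
    "qn_iso 4 (alg4 N12 N13 N14 N23 N24 N34 m123 m124 m134 m234)
      (alg4 (f ` left_ops) (Hn 1) (Hn n) (f ` right_ops) (Hn n) (Hn n) qmul qmul qmul qmul)"
proof -
  obtain n f where n: "n \<ge> 1" and f: "lin_isometry f N34 (Hn n)"
    and mul: "\<And>c s. c \<in> N13 \<Longrightarrow> s \<in> N34 \<Longrightarrow> f (act c s) = qmul (coordmap ((!) [p0, I, J, K]) 4 c) (f s)"
    using quaternionic_coordinates[OF q] by metis
  have f13: "lin_isometry (coordmap ((!) [p0, I, J, K]) 4) N13 (Hn 1)"
    using lin_isometry_coordmap[OF sub(2)] q by (simp add: Hn_def quaternionic_def)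
  have e: "fsr_unit 0 \<in> Hn n" using n by (auto simp: Hn_def coordsp_def)
  have unit: "qmul a (fsr_unit 0) = a" if a: "a \<in> Hn 1" for a
  proof (rule fsr_eqI)
    fix i :: nat
    define k where "k = i div 4"
    have "i = 4 * k \<or> i = 4 * k + 1 \<or> i = 4 * k + 2 \<or> i = 4 * k + 3" unfolding k_def by presburger
    moreover have "k = 0 \<or> k \<ge> 1" by linarith
    ultimately show "coord (qmul a (fsr_unit 0)) i = coord a i"
      using coord_qmul[OF e, of a k] a
      by (auto simp: Hn_def coordsp_def simp flip: numeral_2_eq_2)
  qed
  show ?thesis
    using that[OF n f13 assemble_multiplication[OF f13 f mul e unit]] by blast
qed

text \<open>Since \<open>N34\<close>, \<open>N24\<close> and \<open>N14\<close> are identified, both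
  halves of the module can share one space \<open>S\<close>. Equal dimensions then make
  \<open>clifford_multI\<close> supply the missing half \<open>c1\<close>.\<close>

lemma scalar_coordinates:
  obtains V S :: "fsr set" and c0 c1 f13 f34 where "V \<noteq> {0}" "S \<noteq> {0}" "graded_cl_module V S S c0 c1"
    "lin_isometry f13 N13 V" "lin_isometry f34 N34 S"
    "\<And>c s. c \<in> N13 \<Longrightarrow> s \<in> N34 \<Longrightarrow> f34 (act c s) = c0 (f13 c) (f34 s)"
proof -
  obtain f13 where f13: "lin_isometry f13 N13 (coordsp (dim N13))"
    using lin_isometry_coordsp_exists[OF fd(2)] by blast
  obtain f34 where f34: "lin_isometry f34 N34 (coordsp (dim N34))"
    using lin_isometry_coordsp_exists[OF fd(6)] by blast
  define c0 where "c0 v s = f34 (act (inv_into N13 f13 v) (inv_into N34 f34 s))" for v s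
  have "isometric_bilinear (coordsp (dim N13)) (coordsp (dim N34)) (coordsp (dim N34)) c0"
    unfolding c0_def[abs_def]
    by (rule isometric_bilinear_transport[OF isoP sub(2,6) f13 f34 f34])
  then obtain c1 where c1: "graded_cl_module (coordsp (dim N13)) (coordsp (dim N34)) (coordsp (dim N34)) c0 c1"
    using clifford_multI[of "coordsp (dim N13)" "coordsp (dim N34)" "coordsp (dim N34)" c0]
    by (auto simp: clifford_mult_def)
  have nz13: "coordsp (dim N13) \<noteq> {0}"
    using image_ops_nonzero[OF f13 p0_in(1)] lin_isometryD(3)[OF f13] by simp
  have nz34: "coordsp (dim N34) \<noteq> {0}"
  proof -
    obtain s where "s \<in> N34" "s \<noteq> 0" using Z_nonzero .
    then have "f34 s \<in> coordsp (dim N34)" "norm (f34 s) \<noteq> 0"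
      using lin_isometryD(4,5)[OF f34] by auto
    then show ?thesis by (metis norm_zero singletonD)
  qed
  have "f34 (act c s) = c0 (f13 c) (f34 s)" if "c \<in> N13" "s \<in> N34" for c s
    using lin_isometryD(6)[OF f13 that(1)] lin_isometryD(6)[OF f34 that(2)] by (simp add: c0_def)
  then show ?thesis by (rule that[OF nz13 nz34 c1 f13 f34])
qed

lemma line_coordinate:
  assumes "onb ((!) [x]) 1 X" "subspace X"
  shows "lin_isometry (coordmap ((!) [x]) 1) X Rline"
    "\<And>a. a \<in> X \<Longrightarrow> a = coord (coordmap ((!) [x]) 1 a) 0 *\<^sub>R x" "x \<in> X"
  using lin_isometry_coordmap[OF assms(2,1)] assms(1)
  by (auto simp: Rline_def onb_def orthonormal_fam_def)

lemma assemble_N1: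
  assumes b: "onb ((!) [p0]) 1 left_ops" and full: "right_ops = N13"
  shows "\<exists>M\<in>N1_family. qn_iso 4 (alg4 N12 N13 N14 N23 N24 N34 m123 m124 m134 m234) M"
proof -
  obtain V S :: "fsr set" and c0 c1 f13 f34 where nz: "V \<noteq> {0}" "S \<noteq> {0}" and cl: "graded_cl_module V S S c0 c1"
    and f13: "lin_isometry f13 N13 V" and f34: "lin_isometry f34 N34 S"
    and c0: "\<And>c s. c \<in> N13 \<Longrightarrow> s \<in> N34 \<Longrightarrow> f34 (act c s) = c0 (f13 c) (f34 s)"
    using scalar_coordinates by metis
  \<comment> \<open>Right multiplication by \<open>y0\<close> carries \<open>x0\<close> to
    \<open>p0\<close>, so \<open>N12\<close> is the line through \<open>x0\<close>.\<close>
  have "onb (\<lambda>i. m123 ([x0] ! i) y0) 1 left_ops"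
    using b by (subst onb_cong[where v = "(!) [p0]"]) (simp_all add: p0_def)
  then have b': "onb ((!) [x0]) 1 N12"
    using x0 lin_isometryD[OF iso_left_ops] sub(1)
    by (intro onb_isometry_pullback[of N12 "\<lambda>x. m123 x y0"]) auto
  define f12 where "f12 = coordmap ((!) [x0]) 1"
  have f12: "lin_isometry f12 N12 Rline" and x: "x = coord (f12 x) 0 *\<^sub>R x0" if "x \<in> N12" for x
    using line_coordinate[OF b' sub(1)] that by (auto simp: f12_def)
  have f23: "lin_isometry (\<lambda>y. f13 (m123 x0 y)) N23 V"
    using lin_isometry_comp[OF iso_right_ops] f13 full by simp
  have "qn_iso 4 (alg4 N12 N13 N14 N23 N24 N34 m123 m124 m134 m234) (N1 V S S c0)"
    unfolding N1_def
  proof (rule assemble[OF f12[OF x0(1)] f13 f23 f34])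
    fix x y assume xy: "x \<in> N12" "y \<in> N23"
    have "m123 x y = coord (f12 x) 0 *\<^sub>R m123 x0 y"
      using x[OF xy(1)] lin_on_scaleR[OF D123(2)[OF xy(2)] x0(1)] by metis
    then show "f13 (m123 x y) = rmul (f12 x) (f13 (m123 x0 y))"
      using lin_on_scaleR[OF lin_isometryD(1)[OF f13] D123(3)[OF x0(1) xy(2)]] by (simp add: rmul_def)
  next
    fix x s assume xs: "x \<in> N12" "s \<in> N34"
    have "m123 x y0 = coord (f12 x) 0 *\<^sub>R p0"
      using x[OF xs(1)] lin_on_scaleR[OF D123(2)[OF y0(1)] x0(1)] unfolding p0_def by metis
    then show "f34 (act (m123 x y0) s) = rmul (f12 x) (f34 s)"
      using xs(2) p0_in by (simp add: P_left P_p0 rmul_def lin_on_scaleR[OF lin_isometryD(1)[OF f34]])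
  qed (auto intro!: c0 D123(3) x0)
  then show ?thesis using cl nz unfolding N1_family_def by blast
qed

lemma assemble_N2:
  assumes b: "onb ((!) [p0]) 1 right_ops" and full: "left_ops = N13"
  shows "\<exists>M\<in>N2_family. qn_iso 4 (alg4 N12 N13 N14 N23 N24 N34 m123 m124 m134 m234) M"
proof -
  obtain V S :: "fsr set" and c0 c1 f13 f34 where nz: "V \<noteq> {0}" "S \<noteq> {0}" and cl: "graded_cl_module V S S c0 c1"
    and f13: "lin_isometry f13 N13 V" and f34: "lin_isometry f34 N34 S"
    and c0: "\<And>c s. c \<in> N13 \<Longrightarrow> s \<in> N34 \<Longrightarrow> f34 (act c s) = c0 (f13 c) (f34 s)"
    using scalar_coordinates by metis
  have "onb (\<lambda>i. m123 x0 ([y0] ! i)) 1 right_ops"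
    using b by (subst onb_cong[where v = "(!) [p0]"]) (simp_all add: p0_def)
  then have b': "onb ((!) [y0]) 1 N23"
    using y0 lin_isometryD[OF iso_right_ops] sub(4)
    by (intro onb_isometry_pullback[of N23 "m123 x0"]) auto
  define f23 where "f23 = coordmap ((!) [y0]) 1"
  have f23: "lin_isometry f23 N23 Rline" and y: "y = coord (f23 y) 0 *\<^sub>R y0" if "y \<in> N23" for y
    using line_coordinate[OF b' sub(4)] that by (auto simp: f23_def)
  have f12: "lin_isometry (\<lambda>x. f13 (m123 x y0)) N12 V"
    using lin_isometry_comp[OF iso_left_ops] f13 full by simp
  have "qn_iso 4 (alg4 N12 N13 N14 N23 N24 N34 m123 m124 m134 m234) (N2 V S S c0)"
    unfolding N2_def
  proof (rule assemble[OF f12 f13 f23[OF y0(1)] f34])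
    fix x y assume xy: "x \<in> N12" "y \<in> N23"
    have "m123 x y = coord (f23 y) 0 *\<^sub>R m123 x y0"
      using y[OF xy(2)] lin_on_scaleR[OF D123(1)[OF xy(1)] y0(1)] by metis
    then show "f13 (m123 x y) = rmul (f23 y) (f13 (m123 x y0))"
      using lin_on_scaleR[OF lin_isometryD(1)[OF f13] D123(3)[OF xy(1) y0(1)]] by (simp add: rmul_def)
  next
    fix y s assume ys: "y \<in> N23" "s \<in> N34"
    have "m123 x0 y = coord (f23 y) 0 *\<^sub>R p0"
      using y[OF ys(1)] lin_on_scaleR[OF D123(1)[OF x0(1)] y0(1)] unfolding p0_def by metis
    then show "f34 (act (m123 x0 y) s) = rmul (f23 y) (f34 s)"
      using ys(2) p0_in by (simp add: P_left P_p0 rmul_def lin_on_scaleR[OF lin_isometryD(1)[OF f34]])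
  qed (auto intro!: c0 D123(3) y0)
  \<comment> \<open>\<open>N2\<close> multiplies from \<open>S1\<close> to \<open>S0\<close>, so
    \<open>c0\<close> has to take the place of the second half of the module.\<close>
  then show ?thesis using graded_cl_module_swap[OF cl] nz unfolding N2_family_def by blast
qed

lemma classify_right_full:
  assumes "dim N23 = dim N13"
  shows "\<exists>M\<in>N1_family \<union> N3_family \<union> N4_family.
    qn_iso 4 (alg4 N12 N13 N14 N23 N24 N34 m123 m124 m134 m234) M"
proof -
  have full: "right_ops = N13"
    using lin_isometryD(3)[OF unit_surj[OF iso123 fd(1,4,2) assms x0]] by (simp add: right_ops_def)
  \<comment> \<open>As \<open>right_ops\<close> is everything, each \<open>c\<close> has the form
    \<open>x0 y\<close>, and \<open>act_product\<close> turns the composite into the operator of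
    \<open>x y\<close>.\<close>
  have "left_absorbs left_ops"
    unfolding left_absorbs_def
  proof (intro ballI)
    fix u c assume "u \<in> left_ops" "c \<in> N13"
    then obtain x y where "x \<in> N12" "u = m123 x y0" "y \<in> N23" "c = m123 x0 y"
      using full by (auto simp: left_ops_def right_ops_def)
    then show "\<exists>w\<in>N13. \<forall>s\<in>N34. act u (act c s) = act w s"
      using act_product D123(3) by metis
  qed
  then consider "onb ((!) [p0]) 1 left_ops" | I where "onb ((!) [p0, I]) 2 N13" "left_ops = N13"
    | I J K where "quaternionic I J K"
    using absorbing_trichotomy[OF ops_facts(1-3)] by blast
  then show ?thesis
  proof cases
    case 1
    then show ?thesis using assemble_N1 full by blast
  next
    case 2
    then show ?thesis using assemble_complex full by blast
  next
    case 3
    then obtain f n where n: "n \<ge> 1" and f: "lin_isometry f N13 (Hn 1)"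
      and i: "qn_iso 4 (alg4 N12 N13 N14 N23 N24 N34 m123 m124 m134 m234)
        (alg4 (f ` left_ops) (Hn 1) (Hn n) (f ` right_ops) (Hn n) (Hn n) qmul qmul qmul qmul)"
      using quaternionic_iso by metis
    have "f ` left_ops \<subseteq> Hn 1" "subspace (f ` left_ops)"
      using lin_isometryD(4)[OF f] ops_facts(1,2)
        subspace_lin_image[OF ops_facts(1) lin_isometryD(1)[OF lin_isometry_restrict[OF f ops_facts(2)]]] by auto
    moreover have "f ` left_ops \<noteq> {0}" by (rule image_ops_nonzero[OF f ops_facts(3)])
    ultimately have "N4 (f ` left_ops) n \<in> N4_family" using n unfolding N4_family_def by blast
    moreover have "f ` right_ops = Hn 1" using full lin_isometryD(3)[OF f] by simp
    ultimately show ?thesis using i unfolding N4_def by auto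
  qed
qed

lemma classify_left_full:
  assumes "dim N12 = dim N13"
  shows "\<exists>M\<in>N2_family \<union> N3_family \<union> N5_family.
    qn_iso 4 (alg4 N12 N13 N14 N23 N24 N34 m123 m124 m134 m234) M"
proof -
  have full: "left_ops = N13"
    using lin_isometryD(3)[OF unit_surj[OF isometric_bilinear_flip[OF iso123] fd(4,1,2) assms y0]]
    by (simp add: left_ops_def)
  \<comment> \<open>Now each \<open>c\<close> has the form \<open>x y0\<close>, which puts the
    operators from \<open>N23\<close> on the right; adjoints bring this back to
    \<open>left_absorbs\<close>.\<close>
  have "right_absorbs right_ops"
    unfolding right_absorbs_def
  proof (intro ballI)
    fix u c assume "u \<in> right_ops" "c \<in> N13"
    then obtain x y where "x \<in> N12" "c = m123 x y0" "y \<in> N23" "u = m123 x0 y"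
      using full by (auto simp: left_ops_def right_ops_def)
    then show "\<exists>w\<in>N13. \<forall>s\<in>N34. act c (act u s) = act w s"
      using act_product D123(3) by metis
  qed
  then have "left_absorbs right_ops" by (rule right_absorbs_imp_left[OF ops_facts(4-6)])
  then consider "onb ((!) [p0]) 1 right_ops" | I where "onb ((!) [p0, I]) 2 N13" "right_ops = N13"
    | I J K where "quaternionic I J K"
    using absorbing_trichotomy[OF ops_facts(4-6)] by blast
  then show ?thesis
  proof cases
    case 1
    then show ?thesis using assemble_N2 full by blast
  next
    case 2
    then show ?thesis using assemble_complex full by blast
  next
    case 3
    then obtain f n where n: "n \<ge> 1" and f: "lin_isometry f N13 (Hn 1)"
      and i: "qn_iso 4 (alg4 N12 N13 N14 N23 N24 N34 m123 m124 m134 m234)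
        (alg4 (f ` left_ops) (Hn 1) (Hn n) (f ` right_ops) (Hn n) (Hn n) qmul qmul qmul qmul)"
      using quaternionic_iso by metis
    have "f ` right_ops \<subseteq> Hn 1" "subspace (f ` right_ops)"
      using lin_isometryD(4)[OF f] ops_facts(4,5)
        subspace_lin_image[OF ops_facts(4) lin_isometryD(1)[OF lin_isometry_restrict[OF f ops_facts(5)]]] by auto
    moreover have "f ` right_ops \<noteq> {0}" by (rule image_ops_nonzero[OF f ops_facts(6)])
    ultimately have "N5 (f ` right_ops) n \<in> N5_family" using n unfolding N5_family_def by blast
    moreover have "f ` left_ops = Hn 1" using full lin_isometryD(3)[OF f] by simp
    ultimately show ?thesis using i unfolding N5_def by auto
  qed
qed

end

section \<open>The bigraded case and duality\<close>

text \<open>Since the Clifford actions are invertible up to scaling, the first commutation relation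
  forces the other three.\<close>
lemma bigraded_moduleI:
  assumes l0: "graded_cl_module V10 S00 S10 l0 l0'" and l1: "graded_cl_module V10 S01 S11 l1 l1'"
    and r0: "graded_cl_module V01 S00 S01 r0 r0'" and r1: "graded_cl_module V01 S10 S11 r1 r1'"
    and comm: "\<And>v w s. v \<in> V10 \<Longrightarrow> w \<in> V01 \<Longrightarrow> s \<in> S00 \<Longrightarrow> r1 w (l0 v s) = l1 v (r0 w s)"
  shows "bigraded_module V10 V01 S00 S10 S01 S11 l0 l0' l1 l1' r0 r0' r1 r1'"
proof -
  have act: "lin_on S (c v)" "lin_on T (c' v)"
    "s \<in> S \<Longrightarrow> c v s \<in> T" "t \<in> T \<Longrightarrow> c' v t \<in> S"
    "s \<in> S \<Longrightarrow> c' v (c v s) = - ((norm v)\<^sup>2 *\<^sub>R s)" "t \<in> T \<Longrightarrow> c v (c' v t) = - ((norm v)\<^sup>2 *\<^sub>R t)"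
    if "graded_cl_module V S T c c'" "v \<in> V" for V S T :: "fsr set" and c c' v s t
    using that by (auto simp: graded_cl_module_def bilinear_on_def)
  have zero: "c 0 s = 0" "c' 0 t = 0" if "graded_cl_module V S T c c'" "v \<in> V" "s \<in> S" "t \<in> T"
    for V S T :: "fsr set" and c c' v s t
    using that lin_on_zero[of V "\<lambda>v. c v s" v] lin_on_zero[of V "\<lambda>v. c' v t" v]
    by (auto simp: graded_cl_module_def bilinear_on_def)
  \<comment> \<open>\<open>c v\<close> and \<open>c' v\<close> are inverse to each other up to the
    factor \<open>-|v|^2\<close>; dividing by it gives the preimage.\<close>
  have pre: "\<exists>s\<in>S. t = c v s" if "graded_cl_module V S T c c'" "v \<in> V" "v \<noteq> 0" "t \<in> T"
    for V S T :: "fsr set" and c c' v t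
  proof
    have "subspace S" using that by (auto simp: graded_cl_module_def)
    then show "(- 1 / (norm v)\<^sup>2) *\<^sub>R c' v t \<in> S" using act(4)[OF that(1,2,4)] subspace_scale by blast
    show "t = c v ((- 1 / (norm v)\<^sup>2) *\<^sub>R c' v t)"
      using lin_on_scaleR[OF act(1)[OF that(1,2)] act(4)[OF that(1,2,4)], of "- 1 / (norm v)\<^sup>2"]
        act(6)[OF that(1,2,4)] that(3) by simp
  qed
  have lin: "c v (- (k *\<^sub>R s)) = - (k *\<^sub>R c v s)" "c' v (- (k *\<^sub>R t)) = - (k *\<^sub>R c' v t)"
    if "graded_cl_module V S T c c'" "v \<in> V" "s \<in> S" "t \<in> T" for V S T :: "fsr set" and c c' v s t k
    using lin_on_scaleR[OF act(1)[OF that(1,2)] that(3), of "-k"]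
      lin_on_scaleR[OF act(2)[OF that(1,2)] that(4), of "-k"] by simp_all
  have zeros: "0 \<in> S00" "0 \<in> S10" "0 \<in> S01" "0 \<in> S11"
    using l0 l1 by (auto simp: graded_cl_module_def subspace_0)
  show ?thesis
    unfolding bigraded_module_def
  proof (intro conjI l0 l1 r0 r1 ballI comm)
    fix v w s assume v: "v \<in> V10" and w: "w \<in> V01" and s: "s \<in> S10"
    show "l1' v (r1 w s) = r0 w (l0' v s)"
    proof (cases "v = 0")
      case True
      then show ?thesis
        using zero(2)[OF l1 v zeros(3) act(3)[OF r1 w s]] zero(2)[OF l0 v zeros(1) s]
          lin_on_zero[OF act(1)[OF r0 w] zeros(1)] by simp
    next
      case False
      \<comment> \<open>With this \<open>u\<close>, both sides become \<open>-|v|^2\<close> times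
        \<open>r0 w u\<close>.\<close>
      obtain u where u: "u \<in> S00" "s = l0 v u" using pre[OF l0 v False s] by blast
      show ?thesis
        using comm[OF v w u(1)] act(5)[OF l1 v act(3)[OF r0 w u(1)]] act(5)[OF l0 v u(1)]
          lin(1)[OF r0 w u(1) zeros(3)] u(2) by simp
    qed
  next
    fix v w s assume v: "v \<in> V10" and w: "w \<in> V01" and s: "s \<in> S01"
    show "r1' w (l1 v s) = l0 v (r0' w s)"
    proof (cases "w = 0")
      case True
      then show ?thesis
        using zero(2)[OF r1 w zeros(2) act(3)[OF l1 v s]] zero(2)[OF r0 w zeros(1) s]
          lin_on_zero[OF act(1)[OF l0 v] zeros(1)] by simp
    next
      case False
      obtain u where u: "u \<in> S00" "s = r0 w u" using pre[OF r0 w False s] by blast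
      show ?thesis
        using comm[OF v w u(1), symmetric] act(5)[OF r1 w act(3)[OF l0 v u(1)]] act(5)[OF r0 w u(1)]
          lin(1)[OF l0 v u(1) zeros(2)] u(2) by simp
    qed
  next
    fix v w s assume v: "v \<in> V10" and w: "w \<in> V01" and s: "s \<in> S11"
    show "l0' v (r1' w s) = r0' w (l1' v s)"
    proof (cases "v = 0 \<or> w = 0")
      case True
      then show ?thesis
        using zero(2)[OF l0 v zeros(1) act(4)[OF r1 w s]] zero(2)[OF l1 v zeros(3) s]
          zero(2)[OF r1 w zeros(2) s] zero(2)[OF r0 w zeros(1) act(4)[OF l1 v s]]
          lin_on_zero[OF act(2)[OF r0 w] zeros(3)] lin_on_zero[OF act(2)[OF l0 v] zeros(2)] by auto
    next
      case False
      \<comment> \<open>Pulling \<open>s\<close> back to \<open>u\<close> in \<open>S00\<close>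
        along \<open>l1 v\<close> and \<open>r0 w\<close> makes both sides
        \<open>|v|^2 |w|^2 u\<close>.\<close>
      obtain u' where u': "u' \<in> S01" "s = l1 v u'" using pre[OF l1 v _ s] False by blast
      obtain u where u: "u \<in> S00" "u' = r0 w u" using pre[OF r0 w _ u'(1)] False by blast
      have lu: "l0 v u \<in> S10" using act(3)[OF l0 v u(1)] .
      have "s = r1 w (l0 v u)" using comm[OF v w u(1)] u u' by simp
      then have "l0' v (r1' w s) = (norm w)\<^sup>2 *\<^sub>R (norm v)\<^sup>2 *\<^sub>R u"
        using act(5)[OF r1 w lu] lin(2)[OF l0 v zeros(1) lu] act(5)[OF l0 v u(1)] by simp
      moreover have "r0' w (l1' v s) = (norm v)\<^sup>2 *\<^sub>R (norm w)\<^sup>2 *\<^sub>R u"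
        using u'(2) act(5)[OF l1 v u'(1)] lin(2)[OF r0 w zeros(1) u'(1)] act(5)[OF r0 w u(1)] u(2) by simp
      ultimately show ?thesis by (simp add: mult.commute)
    qed
  qed
qed

text \<open>The model algebras live in \<open>fsr\<close>, so all six spaces are first moved to
  coordinate spaces. The dimensions make \<open>N12\<close> a Clifford factor on the left and
  \<open>N34\<close> one on the right.\<close>

lemma bigraded_case:
  fixes N12 N13 N14 N23 N24 N34 :: "'v::real_inner set"
  assumes fd: "fd_subspace N12" "fd_subspace N13" "fd_subspace N14" "fd_subspace N23" "fd_subspace N24"
      "fd_subspace N34"
    and iso123: "isometric_bilinear N12 N23 N13 m123" and iso124: "isometric_bilinear N12 N24 N14 m124"
    and iso134: "isometric_bilinear N13 N34 N14 m134" and iso234: "isometric_bilinear N23 N34 N24 m234"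
    and assoc: "\<And>x y z. x \<in> N12 \<Longrightarrow> y \<in> N23 \<Longrightarrow> z \<in> N34 \<Longrightarrow> m134 (m123 x y) z = m124 x (m234 y z)"
    and nz: "N12 \<noteq> {0}" "N13 \<noteq> {0}" "N14 \<noteq> {0}" "N23 \<noteq> {0}" "N24 \<noteq> {0}" "N34 \<noteq> {0}"
    and dims: "dim N23 = dim N13" "dim N23 = dim N24" "dim N23 = dim N14"
  shows "\<exists>M\<in>N04_family. qn_iso 4 (alg4 N12 N13 N14 N23 N24 N34 m123 m124 m134 m234) M"
proof -
  note sub = fd[THEN fd_subspaceD]
  let ?E = "\<lambda>X. coordsp (dim X)"
  obtain f12 where f12: "lin_isometry f12 N12 (?E N12)" using lin_isometry_coordsp_exists[OF fd(1)] .
  obtain f13 where f13: "lin_isometry f13 N13 (?E N13)" using lin_isometry_coordsp_exists[OF fd(2)] .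
  obtain f14 where f14: "lin_isometry f14 N14 (?E N14)" using lin_isometry_coordsp_exists[OF fd(3)] .
  obtain f23 where f23: "lin_isometry f23 N23 (?E N23)" using lin_isometry_coordsp_exists[OF fd(4)] .
  obtain f24 where f24: "lin_isometry f24 N24 (?E N24)" using lin_isometry_coordsp_exists[OF fd(5)] .
  obtain f34 where f34: "lin_isometry f34 N34 (?E N34)" using lin_isometry_coordsp_exists[OF fd(6)] .
  note inv = lin_isometryD(6)
  define l0 where "l0 v s = f13 (m123 (inv_into N12 f12 v) (inv_into N23 f23 s))" for v s
  define l1 where "l1 v s = f14 (m124 (inv_into N12 f12 v) (inv_into N24 f24 s))" for v s
  \<comment> \<open>\<open>N34\<close> multiplies from the right in the algebra but is the first
    argument of a Clifford action, hence the exchanged order.\<close>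
  define r0 where "r0 w s = f24 (m234 (inv_into N23 f23 s) (inv_into N34 f34 w))" for w s
  define r1 where "r1 w s = f14 (m134 (inv_into N13 f13 s) (inv_into N34 f34 w))" for w s
  have "isometric_bilinear (?E N12) (?E N23) (?E N13) l0"
    unfolding l0_def[abs_def] by (rule isometric_bilinear_transport[OF iso123 sub(1,4) f12 f23 f13])
  then obtain l0' where l0': "graded_cl_module (?E N12) (?E N23) (?E N13) l0 l0'"
    using clifford_multI[of "?E N12" "?E N23" "?E N13" l0] dims by (auto simp: clifford_mult_def)
  have "isometric_bilinear (?E N12) (?E N24) (?E N14) l1"
    unfolding l1_def[abs_def] by (rule isometric_bilinear_transport[OF iso124 sub(1,5) f12 f24 f14])
  then obtain l1' where l1': "graded_cl_module (?E N12) (?E N24) (?E N14) l1 l1'"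
    using clifford_multI[of "?E N12" "?E N24" "?E N14" l1] dims by (auto simp: clifford_mult_def)
  have "isometric_bilinear (?E N34) (?E N23) (?E N24) r0"
    unfolding r0_def[abs_def]
    by (rule isometric_bilinear_flip[OF isometric_bilinear_transport[OF iso234 sub(4,6) f23 f34 f24]])
  then obtain r0' where r0': "graded_cl_module (?E N34) (?E N23) (?E N24) r0 r0'"
    using clifford_multI[of "?E N34" "?E N23" "?E N24" r0] dims by (auto simp: clifford_mult_def)
  have "isometric_bilinear (?E N34) (?E N13) (?E N14) r1"
    unfolding r1_def[abs_def]
    by (rule isometric_bilinear_flip[OF isometric_bilinear_transport[OF iso134 sub(2,6) f13 f34 f14]])
  then obtain r1' where r1': "graded_cl_module (?E N34) (?E N13) (?E N14) r1 r1'"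
    using clifford_multI[of "?E N34" "?E N13" "?E N14" r1] dims by (auto simp: clifford_mult_def)
  have "r1 w (l0 v s) = l1 v (r0 w s)" if "v \<in> ?E N12" "w \<in> ?E N34" "s \<in> ?E N23" for v w s
  proof -
    note i = lin_isometryD(7)[OF f12 that(1)] lin_isometryD(7)[OF f34 that(2)] lin_isometryD(7)[OF f23 that(3)]
    show ?thesis
      using assoc[OF i(1,3,2)] inv[OF f13 isometric_bilinearD(3)[OF iso123 i(1,3)]]
        inv[OF f24 isometric_bilinearD(3)[OF iso234 i(3,2)]]
      by (simp add: l0_def l1_def r0_def r1_def)
  qed
  note bigr = bigraded_moduleI[OF l0' l1' r0' r1' this]
  have Enz: "?E X \<noteq> {0}" if f: "lin_isometry f X (?E X)" and "fd_subspace X" "X \<noteq> {0}" for f and X :: "'v set"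
  proof
    assume "?E X = {0}"
    moreover from unit_vector_exists[OF fd_subspaceD[OF \<open>fd_subspace X\<close>] \<open>X \<noteq> {0}\<close>]
    obtain x where "x \<in> X" "norm x = 1" .
    ultimately show False using lin_isometryD(4,5)[OF f] by fastforce
  qed
  have "N04 (?E N12) (?E N34) (?E N23) (?E N13) (?E N24) (?E N14) l0 l1 r0 r1 \<in> N04_family"
    using bigr Enz[OF f12 fd(1) nz(1)] Enz[OF f13 fd(2) nz(2)] Enz[OF f14 fd(3) nz(3)]
      Enz[OF f23 fd(4) nz(4)] Enz[OF f24 fd(5) nz(5)] Enz[OF f34 fd(6) nz(6)]
    unfolding N04_family_def by blast
  moreover have "qn_iso 4 (alg4 N12 N13 N14 N23 N24 N34 m123 m124 m134 m234)
      (N04 (?E N12) (?E N34) (?E N23) (?E N13) (?E N24) (?E N14) l0 l1 r0 r1)"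
    unfolding N04_def
    by (rule qn_iso_alg4I[OF f12 f13 f14 f23 f24 f34])
      (simp_all add: l0_def l1_def r0_def r1_def inv[OF f12] inv[OF f13] inv[OF f23] inv[OF f24] inv[OF f34])
  ultimately show ?thesis by blast
qed

section \<open>Equivalence, duality and the data of a rank 4 algebra\<close>

lemma qn_iso_alg4_iff:
  "qn_iso 4 A M \<longleftrightarrow> qn_iso 4 (alg4 (Sp A 1 2) (Sp A 1 3) (Sp A 1 4) (Sp A 2 3) (Sp A 2 4) (Sp A 3 4)
     (Mu A 1 2 3) (Mu A 1 2 4) (Mu A 1 3 4) (Mu A 2 3 4)) M"
proof -
  let ?B = "alg4 (Sp A 1 2) (Sp A 1 3) (Sp A 1 4) (Sp A 2 3) (Sp A 2 4) (Sp A 3 4)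
     (Mu A 1 2 3) (Mu A 1 2 4) (Mu A 1 3 4) (Mu A 2 3 4)"
  have Sp: "Sp ?B i j = Sp A i j" if "1 \<le> i \<and> i < j \<and> j \<le> 4" for i j
    using that unfolding pairs_le_4 by (auto simp: sp4_def)
  have Mu: "Mu ?B i j k = Mu A i j k" if "1 \<le> i \<and> i < j \<and> j < k \<and> k \<le> 4" for i j k
    using that unfolding triples_le_4 by (auto simp: mu4_def)
  have Sp': "Sp ?B i j = Sp A i j" "Sp ?B j k = Sp A j k" if "1 \<le> i \<and> i < j \<and> j < k \<and> k \<le> 4" for i j k
    using that by - (rule Sp, linarith)+
  \<comment> \<open>\<open>qn_iso\<close> inspects its algebras only inside the index range, where
    \<open>?B\<close> and \<open>A\<close> agree.\<close>
  show ?thesis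
    unfolding qn_iso_def using Sp Mu Sp' by (simp cong: conj_cong)
qed

lemma qn_iso_imp_equiv:
  assumes "qn_iso n A M"
  shows "qn_equiv n A M"
  unfolding qn_equiv_def
proof (intro exI[of _ id] conjI)
  show "id permutes {1..n}" by (rule permutes_id)
  show "qn_iso n (renum id A) M"
    using assms unfolding qn_iso_def renum_def by (simp add: inv_id)
qed simp

text \<open>The reflection \<open>n + 1 - i\<close> is an involution on \<open>1..n\<close>, so the
  same maps with reflected indices work. This brings a classification of the dual back to
  \<open>A\<close>.\<close>

lemma qn_iso_dual:
  assumes "qn_iso n (qn_dual n A) M"
  shows "qn_iso n A (qn_dual n M)"
proof -
  obtain \<phi> where
    1: "\<And>i j. 1 \<le> i \<and> i < j \<and> j \<le> n \<Longrightarrow> lin_on (Sp (qn_dual n A) i j) (\<phi> i j) \<and>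
        bij_betw (\<phi> i j) (Sp (qn_dual n A) i j) (Sp M i j) \<and>
        (\<forall>x\<in>Sp (qn_dual n A) i j. norm (\<phi> i j x) = norm x)" and
    2: "\<And>i j k x y. 1 \<le> i \<and> i < j \<and> j < k \<and> k \<le> n \<Longrightarrow> x \<in> Sp (qn_dual n A) i j \<Longrightarrow>
        y \<in> Sp (qn_dual n A) j k \<Longrightarrow>
        \<phi> i k (Mu (qn_dual n A) i j k x y) = Mu M i j k (\<phi> i j x) (\<phi> j k y)"
    using assms unfolding qn_iso_def by metis
  show ?thesis
    unfolding qn_iso_def
  proof (intro exI[of _ "\<lambda>i j. \<phi> (n + 1 - j) (n + 1 - i)"] conjI allI impI ballI)
    fix i j assume ij: "1 \<le> i \<and> i < j \<and> j \<le> n"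
    then have "1 \<le> n + 1 - j \<and> n + 1 - j < n + 1 - i \<and> n + 1 - i \<le> n" by auto
    from 1[OF this] ij show "lin_on (Sp A i j) (\<phi> (n + 1 - j) (n + 1 - i))"
      "bij_betw (\<phi> (n + 1 - j) (n + 1 - i)) (Sp A i j) (Sp (qn_dual n M) i j)"
      "\<And>x. x \<in> Sp A i j \<Longrightarrow> norm (\<phi> (n + 1 - j) (n + 1 - i) x) = norm x"
      by (simp_all add: qn_dual_def)
  next
    fix i j k x y assume ijk: "1 \<le> i \<and> i < j \<and> j < k \<and> k \<le> n" and xy: "x \<in> Sp A i j" "y \<in> Sp A j k"
    then have "1 \<le> n + 1 - k \<and> n + 1 - k < n + 1 - j \<and> n + 1 - j < n + 1 - i \<and> n + 1 - i \<le> n" by auto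
    from 2[OF this, of y x] ijk xy
    show "\<phi> (n + 1 - k) (n + 1 - i) (Mu A i j k x y) =
      Mu (qn_dual n M) i j k (\<phi> (n + 1 - j) (n + 1 - i) x) (\<phi> (n + 1 - k) (n + 1 - j) y)"
      by (simp add: qn_dual_def)
  qed
qed

lemma quasiNil_dual:
  assumes "quasiNil n A"
  shows "quasiNil n (qn_dual n A)"
proof -
  have "fd_subspace (Sp (qn_dual n A) i j)" if "1 \<le> i \<and> i < j \<and> j \<le> n" for i j
  proof -
    have "1 \<le> n + 1 - j \<and> n + 1 - j < n + 1 - i \<and> n + 1 - i \<le> n" using that by auto
    then have "fd_subspace (Sp A (n + 1 - j) (n + 1 - i))" using assms unfolding quasiNil_def by blast
    then show ?thesis by (simp add: qn_dual_def)
  qed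
  moreover have "isometric_bilinear (Sp (qn_dual n A) i j) (Sp (qn_dual n A) j k) (Sp (qn_dual n A) i k)
      (Mu (qn_dual n A) i j k)" if "1 \<le> i \<and> i < j \<and> j < k \<and> k \<le> n" for i j k
  proof -
    have "1 \<le> n + 1 - k \<and> n + 1 - k < n + 1 - j \<and> n + 1 - j < n + 1 - i \<and> n + 1 - i \<le> n"
      using that by auto
    then have "isometric_bilinear (Sp A (n + 1 - k) (n + 1 - j)) (Sp A (n + 1 - j) (n + 1 - i))
        (Sp A (n + 1 - k) (n + 1 - i)) (Mu A (n + 1 - k) (n + 1 - j) (n + 1 - i))"
      using assms unfolding quasiNil_def by blast
    from isometric_bilinear_flip[OF this] show ?thesis by (simp add: qn_dual_def)
  qed
  ultimately show ?thesis unfolding quasiNil_def by blast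
qed

lemma quasiNil_4D:
  assumes "quasiNil 4 A"
  shows "fd_subspace (Sp A 1 2)" "fd_subspace (Sp A 1 3)" "fd_subspace (Sp A 1 4)"
    "fd_subspace (Sp A 2 3)" "fd_subspace (Sp A 2 4)" "fd_subspace (Sp A 3 4)"
    "isometric_bilinear (Sp A 1 2) (Sp A 2 3) (Sp A 1 3) (Mu A 1 2 3)"
    "isometric_bilinear (Sp A 1 2) (Sp A 2 4) (Sp A 1 4) (Mu A 1 2 4)"
    "isometric_bilinear (Sp A 1 3) (Sp A 3 4) (Sp A 1 4) (Mu A 1 3 4)"
    "isometric_bilinear (Sp A 2 3) (Sp A 3 4) (Sp A 2 4) (Mu A 2 3 4)"
  using assms unfolding quasiNil_def pairs_le_4 triples_le_4 by metis+

lemma left_case: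
  assumes A: "quasiNil 4 A"
    and assoc: "\<And>x y z. x \<in> Sp A 1 2 \<Longrightarrow> y \<in> Sp A 2 3 \<Longrightarrow> z \<in> Sp A 3 4 \<Longrightarrow>
      Mu A 1 3 4 (Mu A 1 2 3 x y) z = Mu A 1 2 4 x (Mu A 2 3 4 y z)"
    and nz: "Sp A 1 2 \<noteq> {0}" "Sp A 2 3 \<noteq> {0}" "Sp A 3 4 \<noteq> {0}"
    and dims: "dim (Sp A 3 4) = dim (Sp A 1 4)" "dim (Sp A 3 4) = dim (Sp A 2 4)"
      "dim (Sp A 2 3) = dim (Sp A 1 3) \<or> dim (Sp A 1 2) = dim (Sp A 1 3)"
  shows "\<exists>M\<in>N1_family \<union> N2_family \<union> N3_family \<union> N4_family \<union> N5_family. qn_iso 4 A M"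
proof -
  note q = quasiNil_4D[OF A]
  obtain x0 where x0: "x0 \<in> Sp A 1 2" "norm x0 = 1" using unit_vector_exists[OF fd_subspaceD[OF q(1)] nz(1)] .
  obtain y0 where y0: "y0 \<in> Sp A 2 3" "norm y0 = 1" using unit_vector_exists[OF fd_subspaceD[OF q(4)] nz(2)] .
  note full = dims(3)
  interpret left_chain "Sp A 1 2" "Sp A 1 3" "Sp A 1 4" "Sp A 2 3" "Sp A 2 4" "Sp A 3 4"
    "Mu A 1 2 3" "Mu A 1 2 4" "Mu A 1 3 4" "Mu A 2 3 4" x0 y0
    by (rule left_chain.intro; fact q assoc nz dims x0 y0)
  show ?thesis
    using classify_right_full classify_left_full full unfolding qn_iso_alg4_iff[of A] by blast
qed

text \<open>Matrix associativity is applied to three matrices with one possibly nonzero entry each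
  and read off at position \<open>(1, 4)\<close>.\<close>

lemma qn_assoc_4_elem:
  assumes A: "quasiNil 4 A" and assoc: "qn_assoc 4 A"
    and x: "x \<in> Sp A 1 2" and y: "y \<in> Sp A 2 3" and z: "z \<in> Sp A 3 4"
  shows "Mu A 1 3 4 (Mu A 1 2 3 x y) z = Mu A 1 2 4 x (Mu A 2 3 4 y z)"
proof -
  note q = quasiNil_4D[OF A]
  define E where "E a b v = (\<lambda>i j. if i = a \<and> j = b then v else 0)" for a b :: nat and v :: 'a
  have el: "qn_elem 4 A (E a b v)" if "1 \<le> a \<and> a < b \<and> b \<le> 4" "v \<in> Sp A a b" for a b v
    using that A unfolding qn_elem_def E_def quasiNil_def by (auto intro: subspace_0)
  have M: "qn_elem 4 A (E 1 2 x)" "qn_elem 4 A (E 2 3 y)" "qn_elem 4 A (E 3 4 z)"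
    using x y z by (auto intro!: el)
  have z0: "0 \<in> Sp A 1 2" "0 \<in> Sp A 1 3" "0 \<in> Sp A 2 4" "0 \<in> Sp A 2 3" "0 \<in> Sp A 3 4"
    using q by (auto intro!: subspace_0)
  \<comment> \<open>The sum over the middle index 2 or 3 has one extra term; it is a product of
    zeros and vanishes.\<close>
  have zl: "m 0 v = 0" "m u 0 = 0" if "isometric_bilinear X Y Z m" "v \<in> Y" "u \<in> X" "0 \<in> X" "0 \<in> Y"
    for X Y Z m u and v :: 'a
    using isometric_bilinearD(4)[OF that(1) that(4,2)] isometric_bilinearD(4)[OF that(1) that(3,5)] by simp_all
  have s13: "{1<..<3} = {2::nat}" and s14: "{1<..<4} = {2, 3::nat}" and s24: "{2<..<4} = {3::nat}"
    and s12: "{1<..<2} = ({} :: nat set)" and s34: "{3<..<4} = ({} :: nat set)"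
    by auto
  have "qn_prod 4 A (qn_prod 4 A (E 1 2 x) (E 2 3 y)) (E 3 4 z) 1 4 =
      qn_prod 4 A (E 1 2 x) (qn_prod 4 A (E 2 3 y) (E 3 4 z)) 1 4"
    using assoc M unfolding qn_assoc_def by metis
  moreover have "qn_prod 4 A (qn_prod 4 A (E 1 2 x) (E 2 3 y)) (E 3 4 z) 1 4 = Mu A 1 3 4 (Mu A 1 2 3 x y) z"
    using zl[OF q(8) z0(3) x z0(1) z0(3)]
    by (simp add: qn_prod_def E_def s12[simplified] s13[simplified] s14[simplified] z0)
  moreover have "qn_prod 4 A (E 1 2 x) (qn_prod 4 A (E 2 3 y) (E 3 4 z)) 1 4 = Mu A 1 2 4 x (Mu A 2 3 4 y z)"
    using zl[OF q(9) z z0(2) z0(2) z0(5)]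
    by (simp add: qn_prod_def E_def s34[simplified] s24[simplified] s14[simplified] z0)
  ultimately show ?thesis by simp
qed

text \<open>A strictly increasing chain with three steps inside \<open>1..4\<close> can only be
  \<open>1, 2, 3, 4\<close>.\<close>

lemma nil_index_3_nonzero:
  assumes "nil_index 4 A = 3"
  shows "Sp A 1 2 \<noteq> {0}" "Sp A 2 3 \<noteq> {0}" "Sp A 3 4 \<noteq> {0}"
proof -
  \<comment> \<open>Boundedness of the chain lengths ensures that \<open>GREATEST\<close> is
    attained.\<close>
  have bound: "m \<le> 3" if "has_chain 4 A m" for m
  proof -
    from that obtain f where f: "1 \<le> f 0" "f m \<le> (4::nat)" "\<And>r. r < m \<Longrightarrow> f r < f (Suc r)"
      unfolding has_chain_def by blast
    have "r \<le> m \<Longrightarrow> Suc r \<le> f r" for r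
    proof (induction r)
      case (Suc r)
      then show ?case using f(3)[of r] by simp
    qed (use f(1) in simp)
    from this[of m] f(2) show ?thesis by simp
  qed
  have "has_chain 4 A 0" unfolding has_chain_def by (auto intro!: exI[of _ "\<lambda>_. 1"])
  then have "has_chain 4 A (nil_index 4 A)"
    unfolding nil_index_def using bound by (rule GreatestI_nat)
  then obtain f where f: "1 \<le> f 0" "f 3 \<le> (4::nat)"
    and s: "\<And>r. r < 3 \<Longrightarrow> f r < f (Suc r) \<and> Sp A (f r) (f (Suc r)) \<noteq> {0}"
    using assms unfolding has_chain_def by metis
  have s: "f 0 < f 1" "f 1 < f 2" "f 2 < f 3" "Sp A (f 0) (f 1) \<noteq> {0}" "Sp A (f 1) (f 2) \<noteq> {0}"
    "Sp A (f 2) (f 3) \<noteq> {0}"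
    using s[of 0] s[of 1] s[of 2] by (simp_all add: eval_nat_numeral)
  then have "f 0 = 1" "f 1 = 2" "f 2 = 3" "f 3 = 4" using f by linarith+
  from s(4-6)[unfolded this] show "Sp A 1 2 \<noteq> {0}" "Sp A 2 3 \<noteq> {0}" "Sp A 3 4 \<noteq> {0}" .
qed

lemma isometric_bilinear_nonzero:
  assumes "isometric_bilinear X Y Z m" "subspace X" "subspace Y" "X \<noteq> {0}" "Y \<noteq> {0}"
  obtains x y where "x \<in> X" "y \<in> Y" "m x y \<in> Z" "m x y \<noteq> 0"
proof -
  obtain x y where "x \<in> X" "norm x = 1" "y \<in> Y" "norm y = 1"
    using unit_vector_exists assms by metis
  then show ?thesis using that isometric_bilinearD(3,4)[OF assms(1)] by fastforce
qed

theorem mainTheorem4: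
  fixes A :: "'v::real_inner qna"
  assumes "quasiNil 4 A" and "qn_clifford 4 A" and "qn_assoc 4 A" and "nil_index 4 A = 3"
  shows "\<exists>M \<in> N04_family \<union> N1_family \<union> N2_family \<union> N3_family \<union> N4_family \<union> N5_family.
           qn_equiv 4 A M \<or> qn_equiv 4 A (qn_dual 4 M)"
proof -
  note q = quasiNil_4D[OF assms(1)]
  note nz = nil_index_3_nonzero[OF assms(4)]
  note assoc = qn_assoc_4_elem[OF assms(1,3)]
  note sub = q(1-6)[THEN fd_subspaceD]
  have prod_nz: "Z \<noteq> {0}" if "isometric_bilinear X Y Z m" "fd_subspace X" "fd_subspace Y" "X \<noteq> {0}" "Y \<noteq> {0}"
    for X Y Z :: "'v set" and m
    using isometric_bilinear_nonzero[OF that(1) fd_subspaceD[OF that(2)] fd_subspaceD[OF that(3)] that(4,5)] by blast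
  have nz13: "Sp A 1 3 \<noteq> {0}" by (rule prod_nz[OF q(7,1,4) nz(1,2)])
  have nz24: "Sp A 2 4 \<noteq> {0}" by (rule prod_nz[OF q(10,4,6) nz(2,3)])
  have nz14: "Sp A 1 4 \<noteq> {0}" by (rule prod_nz[OF q(8,1,5) nz(1) nz24])
  \<comment> \<open>An isometric product of nonzero spaces is nonzero, so one of the two Clifford
    alternatives must hold.\<close>
  have cliff: "dim (Sp A j k) = dim (Sp A i k) \<or> dim (Sp A i j) = dim (Sp A i k)"
    if ijk: "1 \<le> i \<and> i < j \<and> j < k \<and> k \<le> 4"
      and iso: "isometric_bilinear (Sp A i j) (Sp A j k) (Sp A i k) (Mu A i j k)"
      and fd: "fd_subspace (Sp A i j)" "fd_subspace (Sp A j k)"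
      and ne: "Sp A i j \<noteq> {0}" "Sp A j k \<noteq> {0}" for i j k
  proof -
    have "\<not> (\<forall>x\<in>Sp A i j. \<forall>y\<in>Sp A j k. Mu A i j k x y = 0)"
      using isometric_bilinear_nonzero[OF iso fd_subspaceD[OF fd(1)] fd_subspaceD[OF fd(2)] ne] by metis
    then have "clifford_mult (Sp A i j) (Sp A j k) (Sp A i k) (Mu A i j k) \<or>
        clifford_mult (Sp A j k) (Sp A i j) (Sp A i k) (\<lambda>y x. Mu A i j k x y)"
      using assms(2) ijk unfolding qn_clifford_def by blast
    then show ?thesis
      using clifford_mult_dim_eq[OF _ ne(1) iso] clifford_mult_dim_eq[OF _ ne(2) isometric_bilinear_flip[OF iso]]
      by blast
  qed
  have c: "dim (Sp A 2 3) = dim (Sp A 1 3) \<or> dim (Sp A 1 2) = dim (Sp A 1 3)"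
    "dim (Sp A 2 4) = dim (Sp A 1 4) \<or> dim (Sp A 1 2) = dim (Sp A 1 4)"
    "dim (Sp A 3 4) = dim (Sp A 1 4) \<or> dim (Sp A 1 3) = dim (Sp A 1 4)"
    "dim (Sp A 3 4) = dim (Sp A 2 4) \<or> dim (Sp A 2 3) = dim (Sp A 2 4)"
    using cliff[OF _ q(7,1,4) nz(1,2)] cliff[OF _ q(8,1,5) nz(1) nz24]
      cliff[OF _ q(9,2,6) nz13 nz(3)] cliff[OF _ q(10,4,6) nz(2,3)] by simp_all
  note le = isometric_bilinear_dim_le and flip = isometric_bilinear_flip
  have ineq: "dim (Sp A 2 3) \<le> dim (Sp A 1 3)" "dim (Sp A 1 2) \<le> dim (Sp A 1 3)"
    "dim (Sp A 2 4) \<le> dim (Sp A 1 4)" "dim (Sp A 1 3) \<le> dim (Sp A 1 4)"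
    "dim (Sp A 3 4) \<le> dim (Sp A 2 4)" "dim (Sp A 2 3) \<le> dim (Sp A 2 4)"
    using le[OF q(1,4,2,7) nz(1)] le[OF q(4,1,2) flip[OF q(7)] nz(2)]
      le[OF q(1,5,3,8) nz(1)] le[OF q(6,2,3) flip[OF q(9)] nz(3)]
      le[OF q(4,6,5,10) nz(2)] le[OF q(6,4,5) flip[OF q(10)] nz(3)] .
  \<comment> \<open>Write \<open>dij\<close> for the dimensions. If \<open>d34 = d14\<close>, then
    \<open>d24\<close> lies between them and the second case holds; if \<open>d12 = d14\<close>,
    then \<open>d13\<close> does and the third holds. Otherwise the dichotomies give
    \<open>d24 = d14 = d13\<close>, and then \<open>d23 = d24\<close>, the first case.\<close>
  consider
      "dim (Sp A 2 3) = dim (Sp A 1 3)" "dim (Sp A 2 3) = dim (Sp A 2 4)" "dim (Sp A 2 3) = dim (Sp A 1 4)"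
    | "dim (Sp A 3 4) = dim (Sp A 1 4)" "dim (Sp A 3 4) = dim (Sp A 2 4)"
      "dim (Sp A 2 3) = dim (Sp A 1 3) \<or> dim (Sp A 1 2) = dim (Sp A 1 3)"
    | "dim (Sp A 1 2) = dim (Sp A 1 4)" "dim (Sp A 1 2) = dim (Sp A 1 3)"
      "dim (Sp A 2 3) = dim (Sp A 2 4) \<or> dim (Sp A 3 4) = dim (Sp A 2 4)"
    using c ineq by linarith
  then show ?thesis
  proof cases
    case 1
    obtain M where "M \<in> N04_family" "qn_iso 4 A M"
      using bigraded_case[OF q assoc nz(1) nz13 nz14 nz(2) nz24 nz(3) 1] unfolding qn_iso_alg4_iff[of A] by blast
    then show ?thesis using qn_iso_imp_equiv by blast
  next
    case 2
    then show ?thesis using left_case[OF assms(1) assoc nz 2] qn_iso_imp_equiv by blast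
  next
    case 3
    \<comment> \<open>Duality exchanges \<open>N12\<close> with \<open>N34\<close> and
      \<open>N13\<close> with \<open>N24\<close>, which turns these equations into those of the
      second case.\<close>
    let ?D = "qn_dual 4 A"
    have Sp: "Sp ?D 1 2 = Sp A 3 4" "Sp ?D 1 3 = Sp A 2 4" "Sp ?D 1 4 = Sp A 1 4" "Sp ?D 2 3 = Sp A 2 3"
      "Sp ?D 2 4 = Sp A 1 3" "Sp ?D 3 4 = Sp A 1 2" by (simp_all add: qn_dual_def)
    have Mu: "Mu ?D 1 2 3 = (\<lambda>x y. Mu A 2 3 4 y x)" "Mu ?D 1 2 4 = (\<lambda>x y. Mu A 1 3 4 y x)"
      "Mu ?D 1 3 4 = (\<lambda>x y. Mu A 1 2 4 y x)" "Mu ?D 2 3 4 = (\<lambda>x y. Mu A 1 2 3 y x)"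
      by (simp_all add: qn_dual_def)
    have "\<exists>M\<in>N1_family \<union> N2_family \<union> N3_family \<union> N4_family \<union> N5_family. qn_iso 4 ?D M"
      by (rule left_case[OF quasiNil_dual[OF assms(1)]]; unfold Sp Mu)
        (use assoc nz 3 in auto)
    then show ?thesis using qn_iso_dual qn_iso_imp_equiv by blast
  qed
qed

end
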